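(* For every $n\ge 3$ and every triangulation $\mathcal{T}$ of $P_n$ such that some triangle of $\mathcal{T}$ does not contain the vertex $0$, there exists a Waldhausen category $\mathcal{C}$ such that the $2$-Segal map $f_{\mathcal{T}}\colon wS_n\mathcal{C}\to\operatorname{holim}_{I\in\mathcal{T}}wS_I\mathcal{C}$ of the simplicial category $wS_\bullet\mathcal{C}$ is not a weak equivalence, i.e. not an equivalence of categories.
   Context: A category with cofibrations is a (small) category $\mathcal{C}$ with a zero object $0$ and a distinguished class of morphisms, the cofibrations (written $\rightarrowtail$), such that: for every object $A$ the map $0\to A$ is a cofibration; every isomorphism is a cofibration; cofibrations are closed under composition; the pushout of a cofibration along any morphism exists and is a cofibration. A cofibration sequence $A\rightarrowtail B\twoheadrightarrow D$ is a cofibration followed by its cokernel, i.e. $D$ is a pushout of $0\leftarrow A\rightarrowtail B$. A Waldhausen category is a category with cofibrations together with a class $w$ of morphisms (weak equivalences) containing all isomorphisms, closed under composition, and such that for every commutative diagram from $B\leftarrowtail A\to C$ to $B'\leftarrowtail A'\to C'$ whose three vertical maps are in $w$, the induced map $B\cup_A C\to B'\cup_{A'}C'$ is in $w$. For a finite nonempty totally ordered set $I$ (e.g. $[n]=\{0<1<\dots<n\}$), $\mathrm{Ar}(I)$ is the poset of pairs $(i,j)$, $i\le j$ in $I$, with $(i,j)\le(i',j')$ iff $i\le i'$ and $j\le j'$. $S_I\mathcal{C}$ is the full subcategory of functors $A\colon \mathrm{Ar}(I)\to\mathcal{C}$, $(i,j)\mapsto A_{i,j}$, with $A_{j,j}=0$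 for all $j$ and $A_{i,j}\rightarrowtail A_{i,k}\twoheadrightarrow A_{j,k}$ a cofibration sequence for all $i<j<k$; $S_n\mathcal{C}=S_{[n]}\mathcal{C}$. $wS_I\mathcal{C}$ is the subcategory of $S_I\mathcal{C}$ with all objects and with morphisms the natural transformations that are componentwise in $w$. Precomposition makes $wS_\bullet\mathcal{C}$ a simplicial category. $P_n$ is the regular $(n+1)$-gon with vertices labeled cyclically $0,1,\dots,n$. A triangulation $\mathcal{T}$ of $P_n$ is a subdivision into triangles with vertices among those of $P_n$; a diagonal is an edge of a triangle that is not an edge of $P_n$. Regard $\mathcal{T}$ as the poset (under inclusion) of vertex sets of its triangles and diagonals. The restriction functors $X_n\to X_I$ for $I\subseteq[n]$ (where $X_I\cong X_{|I|-1}$) induce the $2$-Segal map $f_{\mathcal{T}}\colon X_n\to\operatorname{holim}_{I\in\mathcal{T}}X_I$ of a simplicial category $X$; the target is the iterated homotopy fiber product of the $X_T$ ($T$ a triangle) over the $X_e$ ($e$ a diagonal). Homotopy limits of categories are taken in the canonical model structure on small categories (weak equivalences: equivalences of categories; cofibrations: functors injective on objects; fibrations: isofibrations). *)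

theory Defs
  imports "HOL-Analysis.Analysis"
begin

section \<open>Small categories, functors, equivalences\<close>

record ('o, 'm) cat =
  Obj :: "'o set"
  Arr :: "'m set"
  Dom :: "'m \<Rightarrow> 'o"
  Cod :: "'m \<Rightarrow> 'o"
  Ident :: "'o \<Rightarrow> 'm"
  Comp :: "'m \<Rightarrow> 'm \<Rightarrow> 'm"

text \<open>\<open>Comp C g f\<close> is the composite "first \<open>f\<close>, then \<open>g\<close>".\<close>

definition hom :: "('o, 'm, 'z) cat_scheme \<Rightarrow> 'o \<Rightarrow> 'o \<Rightarrow> 'm set" where
  "hom C a b = {f \<in> Arr C. Dom C f = a \<and> Cod C f = b}"

locale category =
  fixes C :: "('o, 'm, 'z) cat_scheme"
  assumes Dom_Obj: "f \<in> Arr C \<Longrightarrow> Dom C f \<in> Obj C"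
    and Cod_Obj: "f \<in> Arr C \<Longrightarrow> Cod C f \<in> Obj C"
    and Ident_hom: "a \<in> Obj C \<Longrightarrow> Ident C a \<in> hom C a a"
    and Comp_hom: "f \<in> hom C a b \<Longrightarrow> g \<in> hom C b c \<Longrightarrow> Comp C g f \<in> hom C a c"
    and Comp_Ident_left: "f \<in> hom C a b \<Longrightarrow> Comp C (Ident C b) f = f"
    and Comp_Ident_right: "f \<in> hom C a b \<Longrightarrow> Comp C f (Ident C a) = f"
    and Comp_assoc: "f \<in> hom C a b \<Longrightarrow> g \<in> hom C b c \<Longrightarrow> h \<in> hom C c d \<Longrightarrow>
      Comp C h (Comp C g f) = Comp C (Comp C h g) f"

definition is_iso :: "('o, 'm, 'z) cat_scheme \<Rightarrow> 'm \<Rightarrow> bool" where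
  "is_iso C f \<longleftrightarrow> f \<in> Arr C \<and>
     (\<exists>g \<in> hom C (Cod C f) (Dom C f).
        Comp C g f = Ident C (Dom C f) \<and> Comp C f g = Ident C (Cod C f))"

definition full_subcat ::
    "('o, 'm, 'z) cat_scheme \<Rightarrow> ('o \<Rightarrow> bool) \<Rightarrow> ('o, 'm, 'z) cat_scheme" where
  "full_subcat C P = C\<lparr>Obj := {x \<in> Obj C. P x},
                       Arr := {f \<in> Arr C. P (Dom C f) \<and> P (Cod C f)}\<rparr>"

definition wide_subcat ::
    "('o, 'm, 'z) cat_scheme \<Rightarrow> ('m \<Rightarrow> bool) \<Rightarrow> ('o, 'm, 'z) cat_scheme" where
  "wide_subcat C Q = C\<lparr>Arr := {f \<in> Arr C. Q f}\<rparr>"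

record ('o, 'm, 'p, 'q) func =
  fobj :: "'o \<Rightarrow> 'p"
  farr :: "'m \<Rightarrow> 'q"

definition is_functor ::
    "('o, 'm, 'z) cat_scheme \<Rightarrow> ('p, 'q, 'y) cat_scheme \<Rightarrow> ('o, 'm, 'p, 'q) func \<Rightarrow> bool" where
  "is_functor C D F \<longleftrightarrow>
     (\<forall>a \<in> Obj C. fobj F a \<in> Obj D) \<and>
     (\<forall>f \<in> Arr C. farr F f \<in> hom D (fobj F (Dom C f)) (fobj F (Cod C f))) \<and>
     (\<forall>a \<in> Obj C. farr F (Ident C a) = Ident D (fobj F a)) \<and>
     (\<forall>f \<in> Arr C. \<forall>g \<in> Arr C. Cod C f = Dom C g \<longrightarrow>
        farr F (Comp C g f) = Comp D (farr F g) (farr F f))"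

definition id_func :: "('o, 'm, 'o, 'm) func" where
  "id_func = \<lparr>fobj = (\<lambda>a. a), farr = (\<lambda>f. f)\<rparr>"

definition comp_func ::
    "('p, 'q, 'r, 's) func \<Rightarrow> ('o, 'm, 'p, 'q) func \<Rightarrow> ('o, 'm, 'r, 's) func" where
  "comp_func G F = \<lparr>fobj = fobj G \<circ> fobj F, farr = farr G \<circ> farr F\<rparr>"

definition nat_transf ::
    "('o, 'm, 'z) cat_scheme \<Rightarrow> ('p, 'q, 'y) cat_scheme \<Rightarrow>
     ('o, 'm, 'p, 'q) func \<Rightarrow> ('o, 'm, 'p, 'q) func \<Rightarrow> ('o \<Rightarrow> 'q) \<Rightarrow> bool" where
  "nat_transf C D F G t \<longleftrightarrow>
     (\<forall>a \<in> Obj C. t a \<in> hom D (fobj F a) (fobj G a)) \<and>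
     (\<forall>f \<in> Arr C. Comp D (t (Cod C f)) (farr F f) = Comp D (farr G f) (t (Dom C f)))"

definition nat_iso ::
    "('o, 'm, 'z) cat_scheme \<Rightarrow> ('p, 'q, 'y) cat_scheme \<Rightarrow>
     ('o, 'm, 'p, 'q) func \<Rightarrow> ('o, 'm, 'p, 'q) func \<Rightarrow> ('o \<Rightarrow> 'q) \<Rightarrow> bool" where
  "nat_iso C D F G t \<longleftrightarrow> nat_transf C D F G t \<and> (\<forall>a \<in> Obj C. is_iso D (t a))"

text \<open>The weak equivalences of the canonical model structure on small categories.\<close>

definition is_equivalence ::
    "('o, 'm, 'z) cat_scheme \<Rightarrow> ('p, 'q, 'y) cat_scheme \<Rightarrow> ('o, 'm, 'p, 'q) func \<Rightarrow> bool" where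
  "is_equivalence C D F \<longleftrightarrow> is_functor C D F \<and>
     (\<exists>G s t. is_functor D C G \<and>
        nat_iso C C id_func (comp_func G F) s \<and> nat_iso D D (comp_func F G) id_func t)"

text \<open>Functors as objects and natural transformations as morphisms of a category. Values outside
  the source category are fixed to \<open>undefined\<close>, so that equality is equality of functors.\<close>

record ('o, 'm, 'p, 'q) ntrans =
  nsrc :: "('o, 'm, 'p, 'q) func"
  ntgt :: "('o, 'm, 'p, 'q) func"
  ncomp :: "'o \<Rightarrow> 'q"

definition functor_cat ::
    "('o, 'm, 'z) cat_scheme \<Rightarrow> ('p, 'q, 'y) cat_scheme \<Rightarrow>
     (('o, 'm, 'p, 'q) func, ('o, 'm, 'p, 'q) ntrans) cat" where
  "functor_cat J D =
    (let Fs = {F. is_functor J D F \<and> fobj F \<in> extensional (Obj J) \<and> farr F \<in> extensional (Arr J)}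
     in \<lparr>Obj = Fs,
         Arr = {t. nsrc t \<in> Fs \<and> ntgt t \<in> Fs \<and> ncomp t \<in> extensional (Obj J) \<and>
                   nat_transf J D (nsrc t) (ntgt t) (ncomp t)},
         Dom = nsrc,
         Cod = ntgt,
         Ident = (\<lambda>F. \<lparr>nsrc = F, ntgt = F, ncomp = (\<lambda>a \<in> Obj J. Ident D (fobj F a))\<rparr>),
         Comp = (\<lambda>t s. \<lparr>nsrc = nsrc s, ntgt = ntgt t,
                        ncomp = (\<lambda>a \<in> Obj J. Comp D (ncomp t a) (ncomp s a))\<rparr>)\<rparr>)"


section \<open>Waldhausen categories\<close>

definition zero_object :: "('o, 'm, 'z) cat_scheme \<Rightarrow> 'o \<Rightarrow> bool" where
  "zero_object C z \<longleftrightarrow> z \<in> Obj C \<and>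
     (\<forall>a \<in> Obj C. (\<exists>!f. f \<in> hom C z a) \<and> (\<exists>!f. f \<in> hom C a z))"

text \<open>\<open>is_pushout C i f g j\<close>: the square with \<open>i : A \<rightarrow> B\<close>, \<open>f : A \<rightarrow> X\<close>, \<open>g : B \<rightarrow> P\<close>, \<open>j : X \<rightarrow> P\<close>
  is a pushout; \<open>j\<close> is the pushout of \<open>i\<close> along \<open>f\<close>.\<close>

definition is_pushout :: "('o, 'm, 'z) cat_scheme \<Rightarrow> 'm \<Rightarrow> 'm \<Rightarrow> 'm \<Rightarrow> 'm \<Rightarrow> bool" where
  "is_pushout C i f g j \<longleftrightarrow>
     i \<in> Arr C \<and> f \<in> Arr C \<and> g \<in> Arr C \<and> j \<in> Arr C \<and>
     Dom C i = Dom C f \<and> Dom C g = Cod C i \<and> Dom C j = Cod C f \<and> Cod C g = Cod C j \<and>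
     Comp C g i = Comp C j f \<and>
     (\<forall>u \<in> Arr C. \<forall>v \<in> Arr C.
        Dom C u = Cod C i \<and> Dom C v = Cod C f \<and> Cod C u = Cod C v \<and> Comp C u i = Comp C v f \<longrightarrow>
        (\<exists>!h. h \<in> hom C (Cod C g) (Cod C u) \<and> Comp C h g = u \<and> Comp C h j = v))"

record ('o, 'm) wald = "('o, 'm) cat" +
  zero_obj :: 'o
  cofs :: "'m set"
  weqs :: "'m set"

locale category_with_cofibrations = category C for C :: "('o, 'm, 'z) wald_scheme" +
  assumes zero_object: "zero_object C (zero_obj C)"
    and cofs_Arr: "cofs C \<subseteq> Arr C"
    and zero_cof: "f \<in> hom C (zero_obj C) a \<Longrightarrow> f \<in> cofs C"
    and iso_cof: "is_iso C f \<Longrightarrow> f \<in> cofs C"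
    and Comp_cof: "f \<in> cofs C \<Longrightarrow> g \<in> cofs C \<Longrightarrow> Cod C f = Dom C g \<Longrightarrow> Comp C g f \<in> cofs C"
    and pushout_exists: "i \<in> cofs C \<Longrightarrow> f \<in> Arr C \<Longrightarrow> Dom C i = Dom C f \<Longrightarrow>
      \<exists>g j. is_pushout C i f g j"
    and pushout_cof: "i \<in> cofs C \<Longrightarrow> is_pushout C i f g j \<Longrightarrow> j \<in> cofs C"

locale waldhausen_category = category_with_cofibrations C for C :: "('o, 'm, 'z) wald_scheme" +
  assumes weqs_Arr: "weqs C \<subseteq> Arr C"
    and iso_weq: "is_iso C f \<Longrightarrow> f \<in> weqs C"
    and Comp_weq: "f \<in> weqs C \<Longrightarrow> g \<in> weqs C \<Longrightarrow> Cod C f = Dom C g \<Longrightarrow> Comp C g f \<in> weqs C"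
    and gluing:
      "\<lbrakk>i \<in> cofs C; i' \<in> cofs C; is_pushout C i f g j; is_pushout C i' f' g' j';
        a \<in> weqs C; b \<in> weqs C; c \<in> weqs C;
        a \<in> hom C (Dom C i) (Dom C i'); b \<in> hom C (Cod C i) (Cod C i');
        c \<in> hom C (Cod C f) (Cod C f');
        Comp C b i = Comp C i' a; Comp C c f = Comp C f' a;
        h \<in> hom C (Cod C g) (Cod C g');
        Comp C h g = Comp C g' b; Comp C h j = Comp C j' c\<rbrakk> \<Longrightarrow> h \<in> weqs C"

text \<open>\<open>p\<close> is a cokernel of the cofibration \<open>i\<close>: a pushout of \<open>i\<close> along the map to the zero object.\<close>

definition cofibration_sequence :: "('o, 'm, 'z) wald_scheme \<Rightarrow> 'm \<Rightarrow> 'm \<Rightarrow> bool" where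
  "cofibration_sequence C i p \<longleftrightarrow> i \<in> cofs C \<and>
     (\<exists>f j. f \<in> hom C (Dom C i) (zero_obj C) \<and> is_pushout C i f p j)"


section \<open>The \<open>S\<close>-construction\<close>

definition Ar :: "'i::linorder set \<Rightarrow> ('i \<times> 'i, ('i \<times> 'i) \<times> ('i \<times> 'i)) cat" where
  "Ar I = (let Ps = {(i, j). i \<in> I \<and> j \<in> I \<and> i \<le> j}
     in \<lparr>Obj = Ps,
         Arr = {(x, y). x \<in> Ps \<and> y \<in> Ps \<and> fst x \<le> fst y \<and> snd x \<le> snd y},
         Dom = fst,
         Cod = snd,
         Ident = (\<lambda>x. (x, x)),
         Comp = (\<lambda>g f. (fst f, snd g))\<rparr>)"

type_synonym ('i, 'o, 'm) diagram = "('i \<times> 'i, ('i \<times> 'i) \<times> ('i \<times> 'i), 'o, 'm) func"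
type_synonym ('i, 'o, 'm) diagram_map = "('i \<times> 'i, ('i \<times> 'i) \<times> ('i \<times> 'i), 'o, 'm) ntrans"

definition S_obj :: "('o, 'm, 'z) wald_scheme \<Rightarrow> 'i::linorder set \<Rightarrow> ('i, 'o, 'm) diagram \<Rightarrow> bool"
  where
  "S_obj C I A \<longleftrightarrow>
     (\<forall>j \<in> I. fobj A (j, j) = zero_obj C) \<and>
     (\<forall>i \<in> I. \<forall>j \<in> I. \<forall>k \<in> I. i < j \<and> j < k \<longrightarrow>
        cofibration_sequence C (farr A ((i, j), (i, k))) (farr A ((i, k), (j, k))))"

definition S_cat :: "('o, 'm, 'z) wald_scheme \<Rightarrow> 'i::linorder set \<Rightarrow>
    (('i, 'o, 'm) diagram, ('i, 'o, 'm) diagram_map) cat" where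
  "S_cat C I = full_subcat (functor_cat (Ar I) C) (S_obj C I)"

definition wS_cat :: "('o, 'm, 'z) wald_scheme \<Rightarrow> 'i::linorder set \<Rightarrow>
    (('i, 'o, 'm) diagram, ('i, 'o, 'm) diagram_map) cat" where
  "wS_cat C I = wide_subcat (S_cat C I) (\<lambda>t. \<forall>x \<in> Obj (Ar I). ncomp t x \<in> weqs C)"

text \<open>Precomposition with the inclusion \<open>Ar J \<subseteq> Ar I\<close>, for \<open>J \<subseteq> I\<close>.\<close>

definition restrict_diagram :: "'i::linorder set \<Rightarrow> ('i, 'o, 'm) diagram \<Rightarrow> ('i, 'o, 'm) diagram"
  where
  "restrict_diagram J A =
     \<lparr>fobj = restrict (fobj A) (Obj (Ar J)), farr = restrict (farr A) (Arr (Ar J))\<rparr>"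

definition restriction :: "'i::linorder set \<Rightarrow>
    (('i, 'o, 'm) diagram, ('i, 'o, 'm) diagram_map,
     ('i, 'o, 'm) diagram, ('i, 'o, 'm) diagram_map) func" where
  "restriction J =
     \<lparr>fobj = restrict_diagram J,
      farr = (\<lambda>t. \<lparr>nsrc = restrict_diagram J (nsrc t), ntgt = restrict_diagram J (ntgt t),
                   ncomp = restrict (ncomp t) (Obj (Ar J))\<rparr>)\<rparr>"


section \<open>Homotopy limits of categories\<close>

text \<open>\<open>X\<close> is a contravariant diagram of small categories indexed by a poset \<open>P\<close>, with transition
  functors \<open>R q p : X q \<rightarrow> X p\<close> for \<open>p \<le> q\<close>. Its homotopy limit for the canonical model structure is
  given by the Bousfield--Kan end of the functor categories from the contractible groupoids on the
  sets \<open>{q \<in> P. p \<le> q}\<close> to \<open>X p\<close>. Written out, this is the pseudo-limit: an object is a family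
  of objects \<open>x p\<close> with coherent isomorphisms \<open>c (q, p) : R q p (x q) \<rightarrow> x p\<close>, a morphism is a
  compatible family of morphisms (recorded with its source and target). For two maps into one
  category it gives, up to equivalence, the homotopy fibre product of triples \<open>(x, y, R x \<cong> R' y)\<close>.\<close>

type_synonym ('i, 'o, 'm) holim_obj = "('i \<Rightarrow> 'o) \<times> ('i \<times> 'i \<Rightarrow> 'm)"

definition holim_objects :: "'i::order set \<Rightarrow> ('i \<Rightarrow> ('o, 'm, 'z) cat_scheme) \<Rightarrow>
    ('i \<Rightarrow> 'i \<Rightarrow> ('o, 'm, 'o, 'm) func) \<Rightarrow> ('i, 'o, 'm) holim_obj set" where
  "holim_objects P X R = {(x, c).
     x \<in> PiE P (\<lambda>p. Obj (X p)) \<and>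
     c \<in> extensional {(q, p). q \<in> P \<and> p \<in> P \<and> p \<le> q} \<and>
     (\<forall>p \<in> P. \<forall>q \<in> P. p \<le> q \<longrightarrow>
        c (q, p) \<in> hom (X p) (fobj (R q p) (x q)) (x p) \<and> is_iso (X p) (c (q, p))) \<and>
     (\<forall>p \<in> P. c (p, p) = Ident (X p) (x p)) \<and>
     (\<forall>p \<in> P. \<forall>q \<in> P. \<forall>r \<in> P. p \<le> q \<and> q \<le> r \<longrightarrow>
        c (r, p) = Comp (X p) (c (q, p)) (farr (R q p) (c (r, q))))}"

definition holim :: "'i::order set \<Rightarrow> ('i \<Rightarrow> ('o, 'm, 'z) cat_scheme) \<Rightarrow>
    ('i \<Rightarrow> 'i \<Rightarrow> ('o, 'm, 'o, 'm) func) \<Rightarrow>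
    (('i, 'o, 'm) holim_obj,
     ('i, 'o, 'm) holim_obj \<times> ('i, 'o, 'm) holim_obj \<times> ('i \<Rightarrow> 'm)) cat" where
  "holim P X R =
     \<lparr>Obj = holim_objects P X R,
      Arr = {((x, c), (y, d), h).
        (x, c) \<in> holim_objects P X R \<and> (y, d) \<in> holim_objects P X R \<and>
        h \<in> PiE P (\<lambda>p. hom (X p) (x p) (y p)) \<and>
        (\<forall>p \<in> P. \<forall>q \<in> P. p \<le> q \<longrightarrow>
           Comp (X p) (d (q, p)) (farr (R q p) (h q)) = Comp (X p) (h p) (c (q, p)))},
      Dom = (\<lambda>(a, b, h). a),
      Cod = (\<lambda>(a, b, h). b),
      Ident = (\<lambda>a. (a, a, \<lambda>p \<in> P. Ident (X p) (fst a p))),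
      Comp = (\<lambda>(b', d, k) (a, b, h). (a, d, \<lambda>p \<in> P. Comp (X p) (k p) (h p)))\<rparr>"

text \<open>The canonical map \<open>lim \<rightarrow> holim\<close> precomposed with the functor into the strict limit given by a
  cone \<open>G p : Z \<rightarrow> X p\<close> with \<open>R q p \<circ> G q = G p\<close>: all comparison isomorphisms are identities.\<close>

definition to_holim :: "'i::order set \<Rightarrow> ('i \<Rightarrow> ('o, 'm, 'z) cat_scheme) \<Rightarrow>
    ('i \<Rightarrow> ('a, 'b, 'o, 'm) func) \<Rightarrow> ('a, 'b, 'y) cat_scheme \<Rightarrow>
    ('a, 'b, ('i, 'o, 'm) holim_obj,
     ('i, 'o, 'm) holim_obj \<times> ('i, 'o, 'm) holim_obj \<times> ('i \<Rightarrow> 'm)) func" where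
  "to_holim P X G Z =
    (let ob = (\<lambda>a. (\<lambda>p \<in> P. fobj (G p) a,
                    \<lambda>(q, p) \<in> {(q, p). q \<in> P \<and> p \<in> P \<and> p \<le> q}. Ident (X p) (fobj (G p) a)))
     in \<lparr>fobj = ob,
         farr = (\<lambda>f. (ob (Dom Z f), ob (Cod Z f), \<lambda>p \<in> P. farr (G p) f))\<rparr>)"


section \<open>Triangulations of the regular polygon and the 2-Segal map\<close>

definition polygon_vertex :: "nat \<Rightarrow> nat \<Rightarrow> complex" where
  "polygon_vertex n k = cis (2 * pi * real k / real (n + 1))"

definition polygon_hull :: "nat \<Rightarrow> nat set \<Rightarrow> complex set" where
  "polygon_hull n I = convex hull (polygon_vertex n ` I)"

text \<open>A triangulation is given by the vertex sets of its triangles.\<close>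

definition polygon_triangulation :: "nat \<Rightarrow> nat set set \<Rightarrow> bool" where
  "polygon_triangulation n T \<longleftrightarrow>
     (\<forall>I \<in> T. I \<subseteq> {0..n} \<and> card I = 3) \<and>
     triangulation (polygon_hull n ` T) \<and>
     (\<Union>I \<in> T. polygon_hull n I) = polygon_hull n {0..n}"

definition polygon_edges :: "nat \<Rightarrow> nat set set" where
  "polygon_edges n = (\<lambda>k. {k, Suc k mod Suc n}) ` {0..n}"

definition diagonals :: "nat \<Rightarrow> nat set set \<Rightarrow> nat set set" where
  "diagonals n T = {e. card e = 2 \<and> (\<exists>I \<in> T. e \<subseteq> I) \<and> e \<notin> polygon_edges n}"

text \<open>The indexing poset, ordered by inclusion.\<close>

definition triangulation_poset :: "nat \<Rightarrow> nat set set \<Rightarrow> nat set set" where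
  "triangulation_poset n T = T \<union> diagonals n T"

definition wS_holim :: "('o, 'm, 'z) wald_scheme \<Rightarrow> nat \<Rightarrow> nat set set \<Rightarrow>
    ((nat set, (nat, 'o, 'm) diagram, (nat, 'o, 'm) diagram_map) holim_obj,
     (nat set, (nat, 'o, 'm) diagram, (nat, 'o, 'm) diagram_map) holim_obj \<times>
     (nat set, (nat, 'o, 'm) diagram, (nat, 'o, 'm) diagram_map) holim_obj \<times>
     (nat set \<Rightarrow> (nat, 'o, 'm) diagram_map)) cat" where
  "wS_holim C n T = holim (triangulation_poset n T) (wS_cat C) (\<lambda>I J. restriction J)"

definition two_segal_map :: "('o, 'm, 'z) wald_scheme \<Rightarrow> nat \<Rightarrow> nat set set \<Rightarrow>
    ((nat, 'o, 'm) diagram, (nat, 'o, 'm) diagram_map,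
     (nat set, (nat, 'o, 'm) diagram, (nat, 'o, 'm) diagram_map) holim_obj,
     (nat set, (nat, 'o, 'm) diagram, (nat, 'o, 'm) diagram_map) holim_obj \<times>
     (nat set, (nat, 'o, 'm) diagram, (nat, 'o, 'm) diagram_map) holim_obj \<times>
     (nat set \<Rightarrow> (nat, 'o, 'm) diagram_map)) func" where
  "two_segal_map C n T =
     to_holim (triangulation_poset n T) (wS_cat C) restriction (wS_cat C {0..n})"

text \<open>A Waldhausen category is carried by subsets of the types \<open>'o\<close> and \<open>'m\<close>. For existence statements
  \<open>nat\<close> is enough: for fixed \<open>n\<close> and \<open>T\<close>, the axioms and the failure of \<open>two_segal_map C n T\<close> to be
  an equivalence are first-order conditions on \<open>C\<close>, so by the downward Loewenheim--Skolem theorem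
  a counterexample on arbitrary small sets yields a countable one.\<close>


section \<open>Well-definedness\<close>

lemma category_Ar: "category (Ar I)"
  by unfold_locales (auto simp: Ar_def hom_def)

lemma category_full_subcat:
  assumes "category C" shows "category (full_subcat C P)"
proof -
  interpret category C by fact
  have h: "hom (full_subcat C P) a b = {f \<in> hom C a b. P a \<and> P b}" for a b
    by (auto simp: hom_def full_subcat_def)
  show ?thesis
    apply unfold_locales
    unfolding h
    using Dom_Obj Cod_Obj Ident_hom Comp_hom Comp_Ident_left Comp_Ident_right Comp_assoc
    by (auto simp: full_subcat_def)
qed

lemma category_wide_subcat:
  assumes "category C" and "\<And>a. a \<in> Obj C \<Longrightarrow> Q (Ident C a)"
    and "\<And>a b c f g. f \<in> hom C a b \<Longrightarrow> g \<in> hom C b c \<Longrightarrow> Q f \<Longrightarrow> Q g \<Longrightarrow> Q (Comp C g f)"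
  shows "category (wide_subcat C Q)"
proof -
  interpret category C by fact
  have h: "hom (wide_subcat C Q) a b = {f \<in> hom C a b. Q f}" for a b
    by (auto simp: hom_def wide_subcat_def)
  show ?thesis
    apply unfold_locales
    unfolding h
    using Dom_Obj Cod_Obj Ident_hom Comp_hom Comp_Ident_left Comp_Ident_right Comp_assoc assms(2,3)
    by (auto simp: wide_subcat_def)
qed

lemma category_functor_cat:
  assumes "category J" "category D" shows "category (functor_cat J D)"
proof -
  interpret J: category J by fact
  interpret D: category D by fact
  define Fs where "Fs = {F. is_functor J D F \<and> fobj F \<in> extensional (Obj J) \<and> farr F \<in> extensional (Arr J)}"
  have fo: "Obj (functor_cat J D) = Fs" by (simp add: functor_cat_def Fs_def Let_def)
  have h: "hom (functor_cat J D) F G = {t. nsrc t = F \<and> ntgt t = G \<and> F \<in> Fs \<and> G \<in> Fs \<and>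
      ncomp t \<in> extensional (Obj J) \<and> nat_transf J D F G (ncomp t)}" for F G
    by (auto simp: hom_def functor_cat_def Fs_def Let_def)
  have arrC: "farr F f \<in> hom D (fobj F (Dom J f)) (fobj F (Cod J f))" if "F \<in> Fs" "f \<in> Arr J" for F f
    using that by (auto simp: Fs_def is_functor_def)
  have nt_id: "nat_transf J D F F (\<lambda>a\<in>Obj J. Ident D (fobj F a))" if "F \<in> Fs" for F
    unfolding nat_transf_def
    using that J.Dom_Obj J.Cod_Obj D.Ident_hom
      D.Comp_Ident_left[OF arrC[OF that]] D.Comp_Ident_right[OF arrC[OF that]]
    by (auto simp: Fs_def is_functor_def)
  have nt_comp: "nat_transf J D F H (\<lambda>a\<in>Obj J. Comp D (t a) (s a))"
    if F: "F \<in> Fs" "G \<in> Fs" "H \<in> Fs" and s: "nat_transf J D F G s" and t: "nat_transf J D G H t" for F G H s t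
    unfolding nat_transf_def
  proof (intro conjI ballI)
    fix a assume "a \<in> Obj J"
    then show "(\<lambda>a\<in>Obj J. Comp D (t a) (s a)) a \<in> hom D (fobj F a) (fobj H a)"
      using s t D.Comp_hom by (auto simp: nat_transf_def)
  next
    fix f assume f: "f \<in> Arr J"
    let ?x = "Dom J f" and ?y = "Cod J f"
    have xy: "?x \<in> Obj J" "?y \<in> Obj J" using f J.Dom_Obj J.Cod_Obj by auto
    have m: "s ?x \<in> hom D (fobj F ?x) (fobj G ?x)" "t ?x \<in> hom D (fobj G ?x) (fobj H ?x)"
      "s ?y \<in> hom D (fobj F ?y) (fobj G ?y)" "t ?y \<in> hom D (fobj G ?y) (fobj H ?y)"
      using s t xy by (auto simp: nat_transf_def)
    have e: "Comp D (s ?y) (farr F f) = Comp D (farr G f) (s ?x)" "Comp D (t ?y) (farr G f) = Comp D (farr H f) (t ?x)"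
      using s t f by (auto simp: nat_transf_def)
    note a = arrC[OF F(1) f] arrC[OF F(2) f] arrC[OF F(3) f]
    have "Comp D (Comp D (t ?y) (s ?y)) (farr F f) = Comp D (farr H f) (Comp D (t ?x) (s ?x))"
      using D.Comp_assoc[OF a(1) m(3,4)] D.Comp_assoc[OF m(1) a(2) m(4)] D.Comp_assoc[OF m(1,2) a(3)] e by simp
    then show "Comp D ((\<lambda>a\<in>Obj J. Comp D (t a) (s a)) ?y) (farr F f) = Comp D (farr H f) ((\<lambda>a\<in>Obj J. Comp D (t a) (s a)) ?x)"
      using xy by simp
  qed
  show ?thesis
  proof
    fix f a b c d g k
    show "f \<in> Arr (functor_cat J D) \<Longrightarrow> Dom (functor_cat J D) f \<in> Obj (functor_cat J D)"
     "f \<in> Arr (functor_cat J D) \<Longrightarrow> Cod (functor_cat J D) f \<in> Obj (functor_cat J D)"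
      by (auto simp: functor_cat_def Let_def)
    show "a \<in> Obj (functor_cat J D) \<Longrightarrow> Ident (functor_cat J D) a \<in> hom (functor_cat J D) a a"
      unfolding h fo by (auto simp: functor_cat_def Let_def nt_id)
    assume f: "f \<in> hom (functor_cat J D) a b"
    have fx: "ncomp f x \<in> hom D (fobj a x) (fobj b x)" if "x \<in> Obj J" for x
      using f that unfolding h by (auto simp: nat_transf_def)
    have fe: "nsrc f = a" "ntgt f = b" "ncomp f \<in> extensional (Obj J)"
      using f unfolding h by auto
    show "Comp (functor_cat J D) (Ident (functor_cat J D) b) f = f" "Comp (functor_cat J D) f (Ident (functor_cat J D) a) = f"
      by (rule ntrans.equality;
          simp add: functor_cat_def fe restrict_def extensional_arb[OF fe(3)] fun_eq_iff
            D.Comp_Ident_left[OF fx] D.Comp_Ident_right[OF fx])+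
    assume g: "g \<in> hom (functor_cat J D) b c"
    show "Comp (functor_cat J D) g f \<in> hom (functor_cat J D) a c"
    proof -
      have "nat_transf J D a c (\<lambda>x\<in>Obj J. Comp D (ncomp g x) (ncomp f x))"
        by (rule nt_comp[of a b c]) (use f g in \<open>simp_all add: h\<close>)
      then show ?thesis
        using f g unfolding h fo by (simp add: functor_cat_def)
    qed
    assume k: "k \<in> hom (functor_cat J D) c d"
    show "Comp (functor_cat J D) k (Comp (functor_cat J D) g f) = Comp (functor_cat J D) (Comp (functor_cat J D) k g) f"
    proof -
      have gx: "ncomp g x \<in> hom D (fobj b x) (fobj c x)" if "x \<in> Obj J" for x
        using g that unfolding h by (auto simp: nat_transf_def)
      have kx: "ncomp k x \<in> hom D (fobj c x) (fobj d x)" if "x \<in> Obj J" for x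
        using k that unfolding h by (auto simp: nat_transf_def)
      show ?thesis
        by (simp add: functor_cat_def Let_def D.Comp_assoc[OF fx gx kx] cong: restrict_cong)
    qed
  qed
qed

lemma category_wS: assumes "waldhausen_category C" shows "category (wS_cat C I)"
proof -
  interpret waldhausen_category C by fact
  have id: "is_iso C (Ident C a)" if "a \<in> Obj C" for a
    using Ident_hom[OF that] Comp_Ident_left[OF Ident_hom[OF that]]
    by (auto simp: is_iso_def hom_def intro!: exI[of _ "Ident C a"])
  have h: "\<And>s t. s \<in> weqs C \<Longrightarrow> t \<in> weqs C \<Longrightarrow> s \<in> hom C a b \<Longrightarrow> t \<in> hom C b c \<Longrightarrow> Comp C t s \<in> weqs C" for a b c
    using Comp_weq by (auto simp: hom_def)
  have cS: "category (S_cat C I)" unfolding S_cat_def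
    by (rule category_full_subcat category_functor_cat category_Ar category_axioms)+
  show ?thesis unfolding wS_cat_def
  proof (rule category_wide_subcat[OF cS]; intro ballI)
    fix F x assume "F \<in> Obj (S_cat C I)" and x: "x \<in> Obj (Ar I)"
    then have "fobj F x \<in> Obj C"
      by (simp add: S_cat_def full_subcat_def functor_cat_def Let_def is_functor_def)
    then show "ncomp (Ident (S_cat C I) F) x \<in> weqs C"
      using x by (simp add: S_cat_def full_subcat_def functor_cat_def Let_def iso_weq id)
  next
    fix F G H f g x
    assume f: "f \<in> hom (S_cat C I) F G" "\<forall>x\<in>Obj (Ar I). ncomp f x \<in> weqs C"
      and g: "g \<in> hom (S_cat C I) G H" "\<forall>x\<in>Obj (Ar I). ncomp g x \<in> weqs C" and x: "x \<in> Obj (Ar I)"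
    have "ncomp f x \<in> hom C (fobj F x) (fobj G x)"
      using f(1) x by (clarsimp simp: S_cat_def full_subcat_def functor_cat_def Let_def nat_transf_def hom_def)
    moreover have "ncomp g x \<in> hom C (fobj G x) (fobj H x)"
      using g(1) x by (clarsimp simp: S_cat_def full_subcat_def functor_cat_def Let_def nat_transf_def hom_def)
    ultimately have "Comp C (ncomp g x) (ncomp f x) \<in> weqs C"
      using f(2) g(2) x by (blast intro: h)
    then show "ncomp (Comp (S_cat C I) g f) x \<in> weqs C"
      using x by (simp add: S_cat_def full_subcat_def functor_cat_def Let_def)
  qed
qed

lemma functor_restriction:
  assumes "J \<subseteq> I" shows "is_functor (wS_cat C I) (wS_cat C J) (restriction J)"
proof -
  have o: "Obj (Ar J) \<subseteq> Obj (Ar I)" and a: "Arr (Ar J) \<subseteq> Arr (Ar I)"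
    using assms by (auto simp: Ar_def)
  have st: "Dom (Ar K) = fst" "Cod (Ar K) = snd" "Ident (Ar K) = (\<lambda>x. (x, x))" "Comp (Ar K) = (\<lambda>g f. (fst f, snd g))"
    for K :: "'a set" by (auto simp: Ar_def)
  have oJ: "fst f \<in> Obj (Ar J)" "snd f \<in> Obj (Ar J)" if "f \<in> Arr (Ar J)" for f
    using that by (auto simp: Ar_def)
  have iJ: "(x, x) \<in> Arr (Ar J)" if "x \<in> Obj (Ar J)" for x
    using that by (auto simp: Ar_def)
  have cJ: "(fst f, snd g) \<in> Arr (Ar J)" if "f \<in> Arr (Ar J)" "g \<in> Arr (Ar J)" "snd f = fst g" for f g
    using that by (auto simp: Ar_def)
  have A: "is_functor (Ar J) C (restrict_diagram J A)" if "is_functor (Ar I) C A" for A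
    using that unfolding is_functor_def restrict_diagram_def st
    by (simp add: oJ iJ cJ subsetD[OF o] subsetD[OF a])
  have S: "S_obj C J (restrict_diagram J A)" if S: "S_obj C I A" for A
  proof -
    have "(i, j) \<in> Obj (Ar J)" "((i,j),(i,k)) \<in> Arr (Ar J)" "((i,k),(j,k)) \<in> Arr (Ar J)"
      if "i \<in> J" "j \<in> J" "k \<in> J" "i < j" "j < k" for i j k
      using that by (auto simp: Ar_def)
    moreover have "(j, j) \<in> Obj (Ar J)" if "j \<in> J" for j using that by (auto simp: Ar_def)
    ultimately show ?thesis
      using S assms unfolding S_obj_def restrict_diagram_def by (simp add: subset_iff)
  qed
  have nt: "nat_transf (Ar J) C (restrict_diagram J A) (restrict_diagram J B) (restrict t (Obj (Ar J)))"
    if "nat_transf (Ar I) C A B t" for A B t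
    using that unfolding nat_transf_def restrict_diagram_def st
    by (simp add: oJ subsetD[OF o] subsetD[OF a])
  have e: "fobj (restrict_diagram J A) \<in> extensional (Obj (Ar J))" "farr (restrict_diagram J A) \<in> extensional (Arr (Ar J))" for A
    by (auto simp: restrict_diagram_def)
  have r: "fobj (restrict_diagram J A) x = fobj A x" if "x \<in> Obj (Ar J)" for A x
    using that by (simp add: restrict_diagram_def)
  have wo: "A \<in> Obj (wS_cat C K) \<longleftrightarrow> is_functor (Ar K) C A \<and> fobj A \<in> extensional (Obj (Ar K)) \<and>
      farr A \<in> extensional (Arr (Ar K)) \<and> S_obj C K A" for K A
    by (simp add: wS_cat_def wide_subcat_def S_cat_def full_subcat_def functor_cat_def)
  have wa: "t \<in> Arr (wS_cat C K) \<longleftrightarrow> nsrc t \<in> Obj (wS_cat C K) \<and> ntgt t \<in> Obj (wS_cat C K) \<and>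
      ncomp t \<in> extensional (Obj (Ar K)) \<and> nat_transf (Ar K) C (nsrc t) (ntgt t) (ncomp t) \<and>
      (\<forall>x \<in> Obj (Ar K). ncomp t x \<in> weqs C)" for K t
    unfolding wo by (simp add: wS_cat_def wide_subcat_def S_cat_def full_subcat_def functor_cat_def) blast
  have wx: "Dom (wS_cat C K) = nsrc" "Cod (wS_cat C K) = ntgt"
    "Ident (wS_cat C K) F = \<lparr>nsrc = F, ntgt = F, ncomp = (\<lambda>a \<in> Obj (Ar K). Ident C (fobj F a))\<rparr>"
    "Comp (wS_cat C K) t u = \<lparr>nsrc = nsrc u, ntgt = ntgt t,
                        ncomp = (\<lambda>a \<in> Obj (Ar K). Comp C (ncomp t a) (ncomp u a))\<rparr>" for K F t u
    by (simp_all add: wS_cat_def wide_subcat_def S_cat_def full_subcat_def functor_cat_def Let_def)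
  have ro: "fobj (restriction J) A = restrict_diagram J A"
    and ra: "farr (restriction J) t = \<lparr>nsrc = restrict_diagram J (nsrc t), ntgt = restrict_diagram J (ntgt t),
                   ncomp = restrict (ncomp t) (Obj (Ar J))\<rparr>" for A t by (simp_all add: restriction_def)
  have 1: "restrict_diagram J A \<in> Obj (wS_cat C J)" if "A \<in> Obj (wS_cat C I)" for A
    using that A S e unfolding wo by blast
  have 2: "farr (restriction J) t \<in> hom (wS_cat C J) (restrict_diagram J (nsrc t)) (restrict_diagram J (ntgt t))"
    if t: "t \<in> Arr (wS_cat C I)" for t
  proof -
    have "ncomp t x \<in> weqs C" if "x \<in> Obj (Ar J)" for x
      using t o that unfolding wa by blast
    then show ?thesis
      using 1 nt t unfolding hom_def wx by (simp add: ra wa)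
  qed
  show ?thesis
    unfolding is_functor_def[of "wS_cat _ _"]
  proof (intro conjI ballI impI)
    fix F show "farr (restriction J) (Ident (wS_cat C I) F) = Ident (wS_cat C J) (fobj (restriction J) F)"
      by (simp add: ro ra wx fun_eq_iff restrict_def r) (use o r in \<open>auto simp: restrict_def\<close>)
  next
    fix f g show "farr (restriction J) (Comp (wS_cat C I) g f) = Comp (wS_cat C J) (farr (restriction J) g) (farr (restriction J) f)"
      by (simp add: ra wx fun_eq_iff restrict_def) (use o in auto)
  qed (use 1 2 in \<open>simp_all add: ro wx\<close>)
qed

lemma category_holim:
  assumes X: "\<And>p. p \<in> P \<Longrightarrow> category (X p)"
    and R: "\<And>p q. p \<in> P \<Longrightarrow> q \<in> P \<Longrightarrow> p \<le> q \<Longrightarrow> is_functor (X q) (X p) (R q p)"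
  shows "category (holim P X R)"
proof -
  have h: "hom (holim P X R) a b = {f. fst f = a \<and> fst (snd f) = b \<and> a \<in> holim_objects P X R \<and> b \<in> holim_objects P X R \<and>
      snd (snd f) \<in> PiE P (\<lambda>p. hom (X p) (fst a p) (fst b p)) \<and> (\<forall>p \<in> P. \<forall>q \<in> P. p \<le> q \<longrightarrow>
           Comp (X p) (snd b (q, p)) (farr (R q p) (snd (snd f) q)) = Comp (X p) (snd (snd f) p) (snd a (q, p)))}" for a b
  proof -
    have A: "t \<in> Arr (holim P X R) \<longleftrightarrow> fst t \<in> holim_objects P X R \<and> fst (snd t) \<in> holim_objects P X R \<and>
      snd (snd t) \<in> PiE P (\<lambda>p. hom (X p) (fst (fst t) p) (fst (fst (snd t)) p)) \<and> (\<forall>p \<in> P. \<forall>q \<in> P. p \<le> q \<longrightarrow>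
           Comp (X p) (snd (fst (snd t)) (q, p)) (farr (R q p) (snd (snd t) q)) = Comp (X p) (snd (snd t) p) (snd (fst t) (q, p)))" for t
      by (simp only: holim_def cat.simps mem_Collect_eq case_prod_beta prod.collapse)
    have "Dom (holim P X R) t = fst t" "Cod (holim P X R) t = fst (snd t)" for t
      by (simp_all only: holim_def cat.simps case_prod_beta)
    then show ?thesis
      by (simp only: hom_def[of "holim P X R"] A) blast
  qed
  have hD: "fst f = a" "fst (snd f) = b" "a \<in> holim_objects P X R" "b \<in> holim_objects P X R"
      "snd (snd f) \<in> PiE P (\<lambda>p. hom (X p) (fst a p) (fst b p))" if "f \<in> hom (holim P X R) a b" for f a b
    using that unfolding h by blast+
  have hS: "Comp (X p) (snd b (q, p)) (farr (R q p) (snd (snd f) q)) = Comp (X p) (snd (snd f) p) (snd a (q, p))"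
    if "f \<in> hom (holim P X R) a b" "p \<in> P" "q \<in> P" "p \<le> q" for f a b p q
    using that unfolding h by blast
  have cx: "Comp (holim P X R) g f = (fst f, fst (snd g), \<lambda>p\<in>P. Comp (X p) (snd (snd g) p) (snd (snd f) p))" for f g
    by (simp only: holim_def cat.simps case_prod_beta)
  have ix: "Ident (holim P X R) a = (a, a, \<lambda>p\<in>P. Ident (X p) (fst a p))" for a
    by (simp only: holim_def cat.simps)
  have ho: "fst a p \<in> Obj (X p)" if "a \<in> holim_objects P X R" "p \<in> P" for a p
    using conjunct1[OF that(1)[unfolded holim_objects_def mem_Collect_eq case_prod_beta]] that(2) by (rule PiE_mem)
  have hc: "snd a (q,p) \<in> hom (X p) (fobj (R q p) (fst a q)) (fst a p)" if "a \<in> holim_objects P X R" "p \<in> P" "q \<in> P" "p \<le> q" for a p q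
    using conjunct1[OF conjunct2[OF conjunct2[OF that(1)[unfolded holim_objects_def mem_Collect_eq case_prod_beta]]]] that(2-)
    by blast
  have Rh: "farr (R q p) f \<in> hom (X p) (fobj (R q p) a) (fobj (R q p) b)" if "p \<in> P" "q \<in> P" "p \<le> q" "f \<in> hom (X q) a b" for p q f a b
    using R[OF that(1-3)] that(4) by (auto simp: is_functor_def hom_def)
  have Rc: "farr (R q p) (Comp (X q) g f) = Comp (X p) (farr (R q p) g) (farr (R q p) f)" if "p \<in> P" "q \<in> P" "p \<le> q" "f \<in> hom (X q) a b" "g \<in> hom (X q) b c" for p q f g a b c
    using R[OF that(1-3)] that(4-) by (auto simp: is_functor_def hom_def)
  have Ri: "farr (R q p) (Ident (X q) a) = Ident (X p) (fobj (R q p) a)" if "p \<in> P" "q \<in> P" "p \<le> q" "a \<in> Obj (X q)" for p q a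
    using R[OF that(1-3)] that(4) by (auto simp: is_functor_def)
  show ?thesis
  proof
    fix f a b c d g k
    show "f \<in> Arr (holim P X R) \<Longrightarrow> Dom (holim P X R) f \<in> Obj (holim P X R)"
      "f \<in> Arr (holim P X R) \<Longrightarrow> Cod (holim P X R) f \<in> Obj (holim P X R)"
      by (auto simp: holim_def)
    show "Ident (holim P X R) a \<in> hom (holim P X R) a a" if "a \<in> Obj (holim P X R)"
    proof -
      have a: "a \<in> holim_objects P X R" using that by (simp add: holim_def)
      have "snd a (q, p) \<in> hom (X p) (fobj (R q p) (fst a q)) (fst a p)" if "p \<in> P" "q \<in> P" "p \<le> q" for p q
        using hc[OF a that] .
      then show ?thesis unfolding h
        using a by (simp add: ix ho[OF a] Ri category.Ident_hom[OF X]
            category.Comp_Ident_left[OF X hc[OF a]] category.Comp_Ident_right[OF X hc[OF a]])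
    qed
    assume f: "f \<in> hom (holim P X R) a b"
    note f' = hD[OF f] and fh = PiE_mem[OF hD(5)[OF f]] and fe = PiE_arb[OF hD(5)[OF f]]
    show "Comp (holim P X R) (Ident (holim P X R) b) f = f" "Comp (holim P X R) f (Ident (holim P X R) a) = f"
      by (simp_all add: cx ix prod_eq_iff fun_eq_iff restrict_def f'(1,2) fe
           category.Comp_Ident_left[OF X fh] category.Comp_Ident_right[OF X fh])
    assume g: "g \<in> hom (holim P X R) b c"
    note g' = hD[OF g] and gh = PiE_mem[OF hD(5)[OF g]]
    note obj = f'(3,4) g'(4)
    have sq: "Comp (X p) (snd c (q, p)) (farr (R q p) (Comp (X q) (snd (snd g) q) (snd (snd f) q)))
       = Comp (X p) (Comp (X p) (snd (snd g) p) (snd (snd f) p)) (snd a (q, p))" if pq: "p \<in> P" "q \<in> P" "p \<le> q" for p q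
    proof -
      interpret category "X p" using X pq by auto
      note 1 = hS[OF f pq] and 2 = hS[OF g pq]
      note fq = Rh[OF pq fh[OF pq(2)]] and gq = Rh[OF pq gh[OF pq(2)]]
      note a' = hc[OF obj(1) pq] and b' = hc[OF obj(2) pq] and c' = hc[OF obj(3) pq]
      show ?thesis
        unfolding Rc[OF pq fh[OF pq(2)] gh[OF pq(2)]] Comp_assoc[OF fq gq c'] 2 Comp_assoc[OF fq b' gh[OF pq(1)], symmetric] 1
        by (rule Comp_assoc[OF a' fh[OF pq(1)] gh[OF pq(1)]])
    qed
    have gfh: "Comp (X p) (snd (snd g) p) (snd (snd f) p) \<in> hom (X p) (fst a p) (fst c p)" if "p \<in> P" for p
      by (rule category.Comp_hom[OF X[OF that] fh[OF that] gh[OF that]])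
    show "Comp (holim P X R) g f \<in> hom (holim P X R) a c"
      unfolding h cx by (simp add: f'(1) g'(2) obj gfh sq)
    assume k: "k \<in> hom (holim P X R) c d"
    note kh = PiE_mem[OF hD(5)[OF k]]
    show "Comp (holim P X R) k (Comp (holim P X R) g f) = Comp (holim P X R) (Comp (holim P X R) k g) f"
      by (simp add: cx category.Comp_assoc[OF X fh gh kh] cong: restrict_cong)
  qed
qed

lemma functor_to_holim:
  assumes X: "\<And>p. p \<in> P \<Longrightarrow> category (X p)"
    and R: "\<And>p q. p \<in> P \<Longrightarrow> q \<in> P \<Longrightarrow> p \<le> q \<Longrightarrow> is_functor (X q) (X p) (R q p)"
    and Z: "category Z"
    and G: "\<And>p. p \<in> P \<Longrightarrow> is_functor Z (X p) (G p)"
    and coneo: "\<And>p q a. p \<in> P \<Longrightarrow> q \<in> P \<Longrightarrow> p \<le> q \<Longrightarrow> a \<in> Obj Z \<Longrightarrow> fobj (R q p) (fobj (G q) a) = fobj (G p) a"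
    and conea: "\<And>p q a. p \<in> P \<Longrightarrow> q \<in> P \<Longrightarrow> p \<le> q \<Longrightarrow> a \<in> Arr Z \<Longrightarrow> farr (R q p) (farr (G q) a) = farr (G p) a"
  shows "is_functor Z (holim P X R) (to_holim P X G Z)"
proof -
  interpret Z: category Z by fact
  have Gh: "farr (G p) f \<in> hom (X p) (fobj (G p) (Dom Z f)) (fobj (G p) (Cod Z f))" if "p \<in> P" "f \<in> Arr Z" for p f
    using G that by (auto simp: is_functor_def)
  have Go: "fobj (G p) a \<in> Obj (X p)" if "p \<in> P" "a \<in> Obj Z" for p a
    using G that by (auto simp: is_functor_def)
  have Gi: "farr (G p) (Ident Z a) = Ident (X p) (fobj (G p) a)" if "p \<in> P" "a \<in> Obj Z" for p a
    using G that by (auto simp: is_functor_def)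
  have Gc: "farr (G p) (Comp Z g f) = Comp (X p) (farr (G p) g) (farr (G p) f)" if "p \<in> P" "f \<in> Arr Z" "g \<in> Arr Z" "Cod Z f = Dom Z g" for p f g
    using G that by (auto simp: is_functor_def)
  have id: "is_iso (X p) (Ident (X p) a)" if "p \<in> P" "a \<in> Obj (X p)" for a p
    using category.Ident_hom[OF X[OF that(1)] that(2)]
      category.Comp_Ident_left[OF X[OF that(1)] category.Ident_hom[OF X[OF that(1)] that(2)]]
    by (auto simp: is_iso_def hom_def intro!: exI[of _ "Ident (X p) a"])
  have ob: "fobj (to_holim P X G Z) a \<in> holim_objects P X R" if "a \<in> Obj Z" for a
  proof -
    have i: "farr (R q p) (Ident (X q) (fobj (G q) a)) = Ident (X p) (fobj (G p) a)" if "p \<in> P" "q \<in> P" "p \<le> q" for p q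
      using R[OF that] Go[OF that(2) \<open>a \<in> Obj Z\<close>] coneo[OF that \<open>a \<in> Obj Z\<close>] by (simp add: is_functor_def)
    have t: "r \<in> P \<Longrightarrow> p \<le> q \<Longrightarrow> q \<le> r \<Longrightarrow> p \<le> r" for p q r by (rule order_trans)
    show ?thesis
      using that unfolding to_holim_def Let_def holim_objects_def
      by (auto simp: i Go id coneo category.Ident_hom[OF X] category.Comp_Ident_left[OF X category.Ident_hom[OF X]] dest: t)
  qed
  have ar: "farr (to_holim P X G Z) f \<in> Arr (holim P X R)" if "f \<in> Arr Z" for f
    using that ob[OF Z.Dom_Obj[OF that]] ob[OF Z.Cod_Obj[OF that]]
    by (auto simp: holim_def to_holim_def Let_def conea Gh category.Comp_Ident_left[OF X Gh] category.Comp_Ident_right[OF X Gh])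
  have zi: "Ident Z a \<in> Arr Z" "Dom Z (Ident Z a) = a" "Cod Z (Ident Z a) = a" if "a \<in> Obj Z" for a
    using Z.Ident_hom[OF that] by (auto simp: hom_def)
  have zc: "Comp Z g f \<in> Arr Z" "Dom Z (Comp Z g f) = Dom Z f" "Cod Z (Comp Z g f) = Cod Z g"
    if "f \<in> Arr Z" "g \<in> Arr Z" "Cod Z f = Dom Z g" for f g
    using Z.Comp_hom[of f "Dom Z f" "Dom Z g" g "Cod Z g"] that by (auto simp: hom_def)
  have dc: "Dom (holim P X R) (farr (to_holim P X G Z) f) = fobj (to_holim P X G Z) (Dom Z f)"
    "Cod (holim P X R) (farr (to_holim P X G Z) f) = fobj (to_holim P X G Z) (Cod Z f)" for f
    by (auto simp: holim_def to_holim_def Let_def)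
  have i: "farr (to_holim P X G Z) (Ident Z a) = Ident (holim P X R) (fobj (to_holim P X G Z) a)" if "a \<in> Obj Z" for a
    using that by (auto simp: holim_def to_holim_def Let_def zi Gi intro!: restrict_ext)
  have c: "farr (to_holim P X G Z) (Comp Z g f) = Comp (holim P X R) (farr (to_holim P X G Z) g) (farr (to_holim P X G Z) f)"
    if "f \<in> Arr Z" "g \<in> Arr Z" "Cod Z f = Dom Z g" for f g
    using that by (auto simp: holim_def to_holim_def Let_def zc Gc intro!: restrict_ext)
  show ?thesis unfolding is_functor_def
    using ob by (simp add: ar i c hom_def dc) (simp add: holim_def)
qed

theorem two_segal_map_functor:
  assumes C: "waldhausen_category C" and T: "polygon_triangulation n T"
  shows "category (wS_cat C {0..n})" "category (wS_holim C n T)"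
    "is_functor (wS_cat C {0..n}) (wS_holim C n T) (two_segal_map C n T)"
proof -
  have sub: "I \<subseteq> {0..n}" if "I \<in> triangulation_poset n T" for I
    using that T unfolding triangulation_poset_def diagonals_def polygon_triangulation_def by blast
  have ao: "Obj (Ar J) \<subseteq> Obj (Ar I)" "Arr (Ar J) \<subseteq> Arr (Ar I)" if "J \<subseteq> I" for I J :: "nat set"
    using that by (auto simp: Ar_def)
  have c: "fobj (restriction J) (fobj (restriction I) A) = fobj (restriction J) A"
    "farr (restriction J) (farr (restriction I) B) = farr (restriction J) B"
    if "J \<subseteq> I" for I J :: "nat set" and A :: "(nat, 'o, 'm) diagram" and B :: "(nat, 'o, 'm) diagram_map"
    using ao[OF that] by (auto simp: restriction_def restrict_diagram_def Int_absorb1)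
  have R: "is_functor (wS_cat C I) (wS_cat C J) (restriction J)" if "J \<le> I" for I J :: "nat set"
    using that by (rule functor_restriction)
  note W = category_wS[OF C]
  show "category (wS_cat C {0..n})" by (rule W)
  show "category (wS_holim C n T)" unfolding wS_holim_def
    by (rule category_holim) (auto intro: W R)
  show "is_functor (wS_cat C {0..n}) (wS_holim C n T) (two_segal_map C n T)"
    unfolding wS_holim_def two_segal_map_def
    by (rule functor_to_holim) (use sub in \<open>blast intro: W R c\<close>)+
qed

end

theory Submission
  imports Defs
begin

text \<open>If a triangle \<open>{a < b < c}\<close> of \<open>T\<close> avoids \<open>0\<close>, then the segment from \<open>0\<close> to \<open>b\<close> crosses the
  edge from \<open>a\<close> to \<open>c\<close>, so no triangle of \<open>T\<close> contains \<open>{0, b}\<close> and the 2-Segal map forgets the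
  entry \<open>A\<^sub>0\<^sub>,\<^sub>b\<close>. Cofibrations need not be monomorphisms: if \<open>X \<rightarrow> 0\<close> is a cofibration with \<open>X \<noteq> 0\<close>,
  then \<open>X = \<dots> = X \<rightarrowtail> 0 = \<dots> = 0\<close> is an object of \<open>S\<^sub>n\<close> whose subquotients all vanish. Two such
  objects, with the jump just before and just after \<open>b\<close>, have the same image but are not isomorphic.\<close>

section \<open>Crossing diagonals\<close>

text \<open>The expression is twice the signed area of the triangle with vertices
  \<open>cis x\<close>, \<open>cis y\<close>, \<open>cis z\<close>. In the half angles it factors as
  four times a product of three sines, each taken strictly between 0 and \<open>pi\<close>.\<close>

lemma sin_triangle_pos:
  fixes x y z :: real
  assumes "x < y" "y < z" "z < x + 2 * pi"
  shows "sin (y - x) + sin (z - y) - sin (z - x) > 0"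
proof -
  define \<alpha> \<beta> where "\<alpha> = (y - x) / 2" and "\<beta> = (z - y) / 2"
  have s: "sin \<alpha> > 0" "sin \<beta> > 0" "sin (\<alpha> + \<beta>) > 0"
    using assms by (auto simp: \<alpha>_def \<beta>_def field_simps intro!: sin_gt_zero)
  have "sin (2 * \<alpha>) + sin (2 * \<beta>) - sin (2 * \<alpha> + 2 * \<beta>) = 4 * sin \<alpha> * sin \<beta> * sin (\<alpha> + \<beta>)"
    unfolding sin_add sin_double cos_double
    using sin_cos_squared_add[of \<alpha>] sin_cos_squared_add[of \<beta>] by algebra
  moreover have "2 * \<alpha> = y - x" "2 * \<beta> = z - y" "2 * \<alpha> + 2 * \<beta> = z - x"
    by (simp_all add: \<alpha>_def \<beta>_def field_simps)
  ultimately show ?thesis using s by simp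
qed

text \<open>The four points form a convex quadrilateral, and the areas of the triangles that its
  diagonals cut off give explicit coordinates for the crossing point.\<close>

lemma cis_segments_cross:
  fixes w x y z :: real
  assumes "w < x" "x < y" "y < z" "z < w + 2 * pi"
  shows "\<exists>p. p \<in> open_segment (cis x) (cis z) \<and> p \<in> closed_segment (cis w) (cis y)"
proof -
  define D where "D = (\<lambda>x y z. sin (y - x) + sin (z - y) - sin (z - x :: real))"
  have pos: "D x y z > 0" "D w y z > 0" "D w x z > 0" "D w x y > 0"
    unfolding D_def using assms by (intro sin_triangle_pos; linarith)+
  define S where "S = D w y z + D w x y"
  \<comment> \<open>The two diagonals cut the same quadrilateral in two ways, so \<open>S\<close> is
    twice its area in either sum.\<close>
  have S: "S = D x y z + D w x z" by (simp add: S_def D_def)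
  \<comment> \<open>The affine dependence of four points in the plane: each one is weighted by the
    area of the triangle on the other three. After division by \<open>S\<close> it equates a point
    of one diagonal with a point of the other.\<close>
  have e: "D x y z * cos w + D w x z * cos y = D w y z * cos x + D w x y * cos z"
    "D x y z * sin w + D w x z * sin y = D w y z * sin x + D w x y * sin z"
    unfolding D_def sin_diff by algebra+
  have S0: "S > 0" using pos by (simp add: S_def)
  define p where "p = (1 - D w x y / S) *\<^sub>R cis x + (D w x y / S) *\<^sub>R cis z"
  \<comment> \<open>Equal endpoints would make the triangle on \<open>w\<close>, \<open>x\<close>,
    \<open>z\<close> degenerate, against its positive area.\<close>
  have ne: "cis x \<noteq> cis z"
  proof
    assume "cis x = cis z"
    then have "cos x = cos z" "sin x = sin z" by (simp_all add: complex_eq_iff)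
    then have "D w x z = 0" "sin (z - x) = 0" by (simp_all add: D_def sin_diff)
    with pos show False by simp
  qed
  have "p \<in> open_segment (cis x) (cis z)"
    unfolding in_segment using ne pos S0 by (intro conjI exI[of _ "D w x y / S"]) (simp_all add: p_def S_def)
  moreover have "p \<in> closed_segment (cis w) (cis y)"
  proof -
    have "1 - D w x y / S = D w y z / S" "1 - D w x z / S = D x y z / S"
      using S0 S by (simp_all add: field_simps S_def)
    then have "p = (1 - D w x z / S) *\<^sub>R cis w + (D w x z / S) *\<^sub>R cis y"
      using e by (simp add: p_def complex_eq_iff add_divide_distrib[symmetric])
    then show ?thesis unfolding in_segment using pos S0 S by (intro exI[of _ "D w x z / S"]) simp
  qed
  ultimately show ?thesis by blast
qed

text \<open>The vertices are the complex roots of unity of order \<open>n + 1\<close>.\<close>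

lemma inj_on_polygon_vertex: "inj_on (polygon_vertex n) {0..n}"
  using bij_betw_imp_inj_on[OF Complex.bij_betw_roots_unity[of "n + 1"]]
  by (simp add: polygon_vertex_def[abs_def] atLeast0AtMost lessThan_Suc_atMost)

text \<open>A vertex lies on the unit circle, so it is an extreme point of the disc and of any hull
  inside the disc that contains it. Extreme points of a convex hull are among the
  generators.\<close>

lemma polygon_vertex_in_hullD:
  assumes "polygon_vertex n k \<in> polygon_hull n I" "k \<le> n" "I \<subseteq> {0..n}"
  shows "k \<in> I"
proof -
  let ?v = "polygon_vertex n"
  have norm: "norm (?v i) = 1" for i by (simp add: polygon_vertex_def)
  have "?v k extreme_point_of (cball 0 1 :: complex set)"
    using dist_decreases_open_segment[of "?v k" _ _ 0]
    by (fastforce simp: extreme_point_of_def norm)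
  moreover have "polygon_hull n I \<subseteq> cball 0 1"
    unfolding polygon_hull_def by (rule hull_minimal) (auto simp: norm)
  ultimately have "?v k extreme_point_of polygon_hull n I"
    using assms(1) by (auto simp: extreme_point_of_def)
  then have "?v k \<in> ?v ` I"
    unfolding polygon_hull_def by (rule extreme_point_of_convex_hull)
  then show ?thesis
    using inj_on_polygon_vertex[of n] assms(2,3) by (auto dest: inj_onD)
qed

text \<open>Two triangles of a triangulation meet in a common face. If \<open>J\<close> contained
  \<open>0\<close> and \<open>b\<close>, this face would meet the open segment from \<open>a\<close>
  to \<open>c\<close>, hence contain both endpoints, and \<open>J\<close> would have four
  vertices.\<close>

lemma triangulation_no_crossing:
  assumes T: "polygon_triangulation n T" and I: "{a, b, c} \<in> T" and J: "J \<in> T"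
    and abc: "0 < a" "a < b" "b < c"
  shows "\<not> {0, b} \<subseteq> J"
proof
  assume zb: "{0, b} \<subseteq> J"
  let ?v = "polygon_vertex n"
  have sub: "{a, b, c} \<subseteq> {0..n}" "J \<subseteq> {0..n}" and J3: "card J = 3"
    using T I J unfolding polygon_triangulation_def by auto
  have face: "(polygon_hull n {a, b, c} \<inter> polygon_hull n J) face_of polygon_hull n {a, b, c}"
    using T imageI[OF I, of "polygon_hull n"] imageI[OF J, of "polygon_hull n"]
    unfolding polygon_triangulation_def triangulation_def by blast
  define \<theta> where "\<theta> = (\<lambda>k. 2 * pi * real k / real (n + 1))"
  have mono: "\<theta> i < \<theta> j" if "i < j" for i j
    unfolding \<theta>_def using that by (intro divide_strict_right_mono mult_strict_left_mono) auto
  \<comment> \<open>The label \<open>n + 1\<close> is one full turn past \<open>0\<close>, so all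
    vertices have angles within a single turn.\<close>
  have "\<theta> c < \<theta> (n + 1)" using sub by (intro mono) auto
  also have "\<theta> (n + 1) = \<theta> 0 + 2 * pi" by (simp add: \<theta>_def)
  finally obtain p where p: "p \<in> open_segment (?v a) (?v c)" "p \<in> closed_segment (?v 0) (?v b)"
    using cis_segments_cross[OF mono[OF abc(1)] mono[OF abc(2)] mono[OF abc(3)]]
    by (auto simp: polygon_vertex_def \<theta>_def)
  have ac: "?v a \<in> polygon_hull n {a, b, c}" "?v c \<in> polygon_hull n {a, b, c}"
    unfolding polygon_hull_def by (auto intro: hull_inc)
  have hm: "closed_segment (?v i) (?v j) \<subseteq> polygon_hull n K" if "i \<in> K" "j \<in> K" for i j K
    unfolding polygon_hull_def segment_convex_hull using that by (intro hull_mono) auto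
  have "p \<in> polygon_hull n {a, b, c} \<inter> polygon_hull n J"
    using p hm[of 0 J b] hm[of a "{a, b, c}" c] zb open_closed_segment by blast
  \<comment> \<open>A face that contains an inner point of a segment of the triangle contains the
    endpoints of that segment.\<close>
  then have "?v a \<in> polygon_hull n J" "?v c \<in> polygon_hull n J"
    using face p(1) ac unfolding face_of_def by blast+
  then have "{0, a, b, c} \<subseteq> J"
    using polygon_vertex_in_hullD[of n _ J] sub zb by auto
  then have "card {0, a, b, c} \<le> card J"
    using J3 by (intro card_mono) (auto intro: card_ge_0_finite)
  then show False using J3 abc by simp
qed

text \<open>Take for \<open>j\<close> the middle vertex of the triangle that avoids
  \<open>0\<close>; its two neighbours in the triangle give the strict bounds.\<close>

lemma exists_uncovered_diagonal:
  assumes T: "polygon_triangulation n T" and I: "I \<in> T" "0 \<notin> I"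
  shows "\<exists>j. 1 < j \<and> j < n \<and> (\<forall>J \<in> T. \<not> {0, j} \<subseteq> J)"
proof -
  have I3: "card I = 3" "I \<subseteq> {0..n}" using T I by (auto simp: polygon_triangulation_def)
  define xs where "xs = sorted_list_of_set I"
  have "finite I" using I3 by (auto intro: card_ge_0_finite)
  then have xs: "sorted_wrt (<) xs" "set xs = I" "length xs = 3"
    using I3 by (simp_all add: xs_def)
  from xs(3) obtain a b c where "xs = [a, b, c]"
    by (auto simp: numeral_3_eq_3 length_Suc_conv)
  with xs I I3 have "I = {a, b, c}" "0 < a" "a < b" "b < c" "c \<le> n"
    by auto
  then show ?thesis
    using triangulation_no_crossing[OF T, of a b c] I by (intro exI[of _ b]) auto
qed

section \<open>Diagrams concentrated in the first row\<close>

context category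
begin

lemma is_iso_comp:
  assumes "f \<in> hom C a b" "is_iso C f" "g \<in> hom C b c" "is_iso C g"
  shows "is_iso C (Comp C g f)"
proof -
  obtain f' where f': "f' \<in> hom C b a" "Comp C f' f = Ident C a" "Comp C f f' = Ident C b"
    using assms(1,2) by (auto simp: is_iso_def hom_def)
  obtain g' where g': "g' \<in> hom C c b" "Comp C g' g = Ident C b" "Comp C g g' = Ident C c"
    using assms(3,4) by (auto simp: is_iso_def hom_def)
  have "Comp C (Comp C f' g') (Comp C g f) = Comp C f' (Comp C (Comp C g' g) f)"
    using Comp_assoc[OF assms(1) assms(3) g'(1)]
      Comp_assoc[OF Comp_hom[OF assms(1,3)] g'(1) f'(1)] by simp
  then have 1: "Comp C (Comp C f' g') (Comp C g f) = Ident C a"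
    using Comp_Ident_left[OF assms(1)] f' g' by simp
  have "Comp C (Comp C g f) (Comp C f' g') = Comp C g (Comp C (Comp C f f') g')"
    using Comp_assoc[OF g'(1) f'(1) assms(1)]
      Comp_assoc[OF Comp_hom[OF g'(1) f'(1)] assms(1,3)] by simp
  then have 2: "Comp C (Comp C g f) (Comp C f' g') = Ident C c"
    using Comp_Ident_left[OF g'(1)] f' g' by simp
  show ?thesis
    unfolding is_iso_def
    using 1 2 Comp_hom[OF assms(1,3)] Comp_hom[OF g'(1) f'(1)]
    by (auto simp: hom_def intro!: bexI[of _ "Comp C f' g'"])
qed

lemma is_iso_inverse:
  assumes "f \<in> hom C a b" "is_iso C f"
  obtains g where "g \<in> hom C b a" "is_iso C g"
  using assms by (auto simp: is_iso_def hom_def)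

lemma is_iso_Ident: "a \<in> Obj C \<Longrightarrow> is_iso C (Ident C a)"
  using Ident_hom[of a] Comp_Ident_left[OF Ident_hom[of a]]
  by (auto simp: is_iso_def hom_def)

lemma hom_zero_unique:
  assumes "zero_object C z" "a \<in> Obj C" "b \<in> Obj C" "a = z \<or> b = z"
  shows "\<exists>!f. f \<in> hom C a b"
  using assms by (auto simp: zero_object_def)

end

text \<open>With this, stability of cofibrations under pushout has to be checked for one chosen
  pushout only.\<close>

lemma (in category) pushout_unique_iso:
  assumes P: "is_pushout C i f g j" and P': "is_pushout C i f g' j'"
  shows "\<exists>h \<in> hom C (Cod C j) (Cod C j'). is_iso C h \<and> Comp C h j = j'"
proof -
  have key: "\<exists>!h. h \<in> hom C (Cod C g) (Cod C u) \<and> Comp C h g = u \<and> Comp C h j = v"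
    if "is_pushout C i f g j" "is_pushout C i f u v" for g j u v
    using that unfolding is_pushout_def by metis
  have c: "Cod C g = Cod C j" "Cod C g' = Cod C j'" using P P' by (auto simp: is_pushout_def)
  have gh: "g \<in> hom C (Dom C g) (Cod C g)" "j \<in> hom C (Dom C j) (Cod C g)"
    "g' \<in> hom C (Dom C g') (Cod C g')" "j' \<in> hom C (Dom C j') (Cod C g')"
    using P P' by (auto simp: is_pushout_def hom_def)
  obtain h where h: "h \<in> hom C (Cod C g) (Cod C g')" "Comp C h g = g'" "Comp C h j = j'"
    using key[OF P P'] by blast
  obtain k where k: "k \<in> hom C (Cod C g') (Cod C g)" "Comp C k g' = g" "Comp C k j' = j"
    using key[OF P' P] by blast
  have "g \<in> Arr C" "g' \<in> Arr C" using P P' by (auto simp: is_pushout_def)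
  then have I: "Ident C (Cod C g) \<in> hom C (Cod C g) (Cod C g)" "Ident C (Cod C g') \<in> hom C (Cod C g') (Cod C g')"
    using Cod_Obj Ident_hom by auto
  have "Comp C (Comp C k h) g = g" "Comp C (Comp C k h) j = j"
    using Comp_assoc[OF gh(1) h(1) k(1)] Comp_assoc[OF gh(2) h(1) k(1)] h k by auto
  then have 1: "Comp C k h = Ident C (Cod C g)"
    using key[OF P P] Comp_hom[OF h(1) k(1)] I Comp_Ident_left[OF gh(1)] Comp_Ident_left[OF gh(2)] by blast
  have "Comp C (Comp C h k) g' = g'" "Comp C (Comp C h k) j' = j'"
    using Comp_assoc[OF gh(3) k(1) h(1)] Comp_assoc[OF gh(4) k(1) h(1)] h k by auto
  then have 2: "Comp C h k = Ident C (Cod C g')"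
    using key[OF P' P'] Comp_hom[OF k(1) h(1)] I Comp_Ident_left[OF gh(3)] Comp_Ident_left[OF gh(4)] by blast
  have "is_iso C h" unfolding is_iso_def using h(1) k(1) 1 2 by (auto simp: hom_def intro!: bexI[of _ k])
  then show ?thesis using h c by auto
qed

text \<open>Composition and identities are computed componentwise, so the components of an inverse
  are inverse to the components. This allows diagrams to be told apart at a single entry.\<close>

lemma wS_iso_component:
  assumes "is_iso (wS_cat C I) t" "x \<in> Obj (Ar I)"
  shows "is_iso C (ncomp t x)"
    and "ncomp t x \<in> hom C (fobj (nsrc t) x) (fobj (ntgt t) x)"
proof -
  have [simp]: "Dom (wS_cat C I) = nsrc" "Cod (wS_cat C I) = ntgt"
    by (simp_all add: wS_cat_def wide_subcat_def S_cat_def full_subcat_def functor_cat_def Let_def)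
  have hom: "ncomp s x \<in> hom C (fobj (nsrc s) x) (fobj (ntgt s) x)" if "s \<in> Arr (wS_cat C I)" for s
    using that assms(2)
    by (auto simp: wS_cat_def wide_subcat_def S_cat_def full_subcat_def functor_cat_def Let_def
        nat_transf_def)
  obtain u where u: "t \<in> Arr (wS_cat C I)" "u \<in> Arr (wS_cat C I)" "nsrc u = ntgt t" "ntgt u = nsrc t"
    "Comp (wS_cat C I) u t = Ident (wS_cat C I) (nsrc t)"
    "Comp (wS_cat C I) t u = Ident (wS_cat C I) (ntgt t)"
    using assms(1) by (auto simp: is_iso_def hom_def)
  have "ncomp (Comp (wS_cat C I) u t) x = ncomp (Ident (wS_cat C I) (nsrc t)) x"
    "ncomp (Comp (wS_cat C I) t u) x = ncomp (Ident (wS_cat C I) (ntgt t)) x"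
    using u by simp_all
  then have "Comp C (ncomp u x) (ncomp t x) = Ident C (fobj (nsrc t) x)"
    "Comp C (ncomp t x) (ncomp u x) = Ident C (fobj (ntgt t) x)"
    using assms(2)
    by (simp_all add: wS_cat_def wide_subcat_def S_cat_def full_subcat_def functor_cat_def Let_def)
  then show "is_iso C (ncomp t x)"
    using hom[OF u(1)] hom[OF u(2)] u(3,4) by (auto simp: is_iso_def hom_def)
  show "ncomp t x \<in> hom C (fobj (nsrc t) x) (fobj (ntgt t) x)"
    by (rule hom[OF u(1)])
qed

section \<open>The filtrations as objects of the S-construction\<close>

definition first_row :: "nat \<Rightarrow> nat \<times> nat \<Rightarrow> bool" where
  "first_row m x \<longleftrightarrow> fst x = 0 \<and> 0 < snd x \<and> snd x \<le> m"

definition first_row_obj :: "('o, 'm, 'z) wald_scheme \<Rightarrow> 'o \<Rightarrow> nat \<Rightarrow> nat \<times> nat \<Rightarrow> 'o" where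
  "first_row_obj C X m x = (if first_row m x then X else zero_obj C)"

text \<open>The filtration \<open>X = \<dots> = X \<rightarrowtail> 0 = \<dots> = 0\<close> with \<open>m\<close> copies of \<open>X\<close>; all its subquotients
  \<open>A\<^sub>i\<^sub>,\<^sub>k\<close> with \<open>i > 0\<close> vanish.\<close>

definition first_row_diagram ::
    "('o, 'm, 'z) wald_scheme \<Rightarrow> 'o \<Rightarrow> nat set \<Rightarrow> nat \<Rightarrow> (nat, 'o, 'm) diagram" where
  "first_row_diagram C X I m =
     \<lparr>fobj = restrict (first_row_obj C X m) (Obj (Ar I)),
      farr = (\<lambda>f \<in> Arr (Ar I). if first_row m (fst f) \<and> first_row m (snd f) then Ident C X
        else THE g. g \<in> hom C (first_row_obj C X m (fst f)) (first_row_obj C X m (snd f)))\<rparr>"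

lemma Ar_simps:
  "Obj (Ar I) = {(i, j). i \<in> I \<and> j \<in> I \<and> i \<le> j}"
  "Arr (Ar I) = {(x, y). x \<in> Obj (Ar I) \<and> y \<in> Obj (Ar I) \<and> fst x \<le> fst y \<and> snd x \<le> snd y}"
  "Dom (Ar I) = fst" "Cod (Ar I) = snd" "Ident (Ar I) = (\<lambda>x. (x, x))"
  "Comp (Ar I) = (\<lambda>g f. (fst f, snd g))"
  by (auto simp: Ar_def)

context category_with_cofibrations
begin

lemma first_row_obj_in_Obj: "X \<in> Obj C \<Longrightarrow> first_row_obj C X m x \<in> Obj C"
  using zero_object by (auto simp: first_row_obj_def zero_object_def)

lemma first_row_diagram_arr_hom:
  assumes X: "X \<in> Obj C" and f: "f \<in> Arr (Ar I)"
  shows "farr (first_row_diagram C X I m) f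
    \<in> hom C (first_row_obj C X m (fst f)) (first_row_obj C X m (snd f))"
proof (cases "first_row m (fst f) \<and> first_row m (snd f)")
  case True
  then show ?thesis
    using f Ident_hom[OF X] by (auto simp: first_row_diagram_def first_row_obj_def)
next
  case False
  \<comment> \<open>At least one end is the zero object, so the definite description denotes the
    only arrow there is.\<close>
  have "\<exists>!g. g \<in> hom C (first_row_obj C X m (fst f)) (first_row_obj C X m (snd f))"
    by (rule hom_zero_unique[OF zero_object])
      (use False in \<open>auto simp: first_row_obj_in_Obj[OF X], auto simp: first_row_obj_def\<close>)
  from theI'[OF this] show ?thesis
    using f False by (auto simp: first_row_diagram_def)
qed

text \<open>Between two copies of \<open>X\<close> all arrows are identities. In every other case
  source or target is zero and parallel arrows agree, which settles the functor laws.\<close>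

lemma is_functor_first_row_diagram:
  assumes X: "X \<in> Obj C"
  shows "is_functor (Ar I) C (first_row_diagram C X I m)" (is "is_functor _ _ ?F")
proof -
  let ?o = "first_row_obj C X m"
  note ho = first_row_obj_in_Obj[OF X] and hom = first_row_diagram_arr_hom[OF X]
  have fo: "fobj ?F x = ?o x" if "x \<in> Obj (Ar I)" for x
    using that by (simp add: first_row_diagram_def)
  have ends: "fst f \<in> Obj (Ar I)" "snd f \<in> Obj (Ar I)" if "f \<in> Arr (Ar I)" for f
    using that by (auto simp: Ar_simps)
  have uniq: "g = h" if "g \<in> hom C (?o x) (?o y)" "h \<in> hom C (?o x) (?o y)"
    "\<not> (first_row m x \<and> first_row m y)" for g h x y
    using that hom_zero_unique[OF zero_object ho ho, of m x m y]
    by (auto simp: first_row_obj_def[of _ _ m x] first_row_obj_def[of _ _ m y] split: if_splits)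
  have id: "farr ?F (x, x) = Ident C (?o x)" if x: "x \<in> Obj (Ar I)" for x
  proof (cases "first_row m x")
    case False
    have "(x, x) \<in> Arr (Ar I)" using x by (auto simp: Ar_simps)
    with False show ?thesis
      by (intro uniq[of _ x x] Ident_hom[OF ho] hom[of "(x, x)", simplified]) auto
  qed (use x in \<open>auto simp: first_row_diagram_def first_row_obj_def Ar_simps\<close>)
  have comp: "farr ?F (fst f, snd g) = Comp C (farr ?F g) (farr ?F f)"
    if f: "f \<in> Arr (Ar I)" and g: "g \<in> Arr (Ar I)" and fg: "snd f = fst g" for f g
  proof -
    have a: "(fst f, snd g) \<in> Arr (Ar I)" using f g fg by (auto simp: Ar_simps)
    show ?thesis
    proof (cases "first_row m (fst f) \<and> first_row m (snd g)")
      case True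
      \<comment> \<open>The copies of \<open>X\<close> form an interval of the poset: a path that
        starts and ends there stays there.\<close>
      then have "first_row m (snd f)" "first_row m (fst g)"
        using f g fg by (auto simp: Ar_simps first_row_def)
      then show ?thesis
        using True f g a Comp_Ident_left[OF Ident_hom[OF X]] by (simp add: first_row_diagram_def)
    next
      case False
      show ?thesis
        by (rule uniq[of _ "fst f" "snd g"])
          (use False hom[OF a] Comp_hom[OF hom[OF f]] hom[OF g] fg in auto)
    qed
  qed
  show ?thesis
    unfolding is_functor_def Ar_simps(3-)
    using ho hom id comp by (simp add: fo ends)
qed

text \<open>The pushout square is completed by the identity of the zero object. Hence the induced
  arrow can only be \<open>v\<close>, and what remains is that \<open>u\<close> factors as
  \<open>v\<close> after \<open>p\<close>.\<close>

lemma cofibration_sequence_zero_cokernel: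
  assumes i: "i \<in> cofs C" and p: "p \<in> hom C (Cod C i) (zero_obj C)"
    and "is_iso C i \<or> Cod C i = zero_obj C"
  shows "cofibration_sequence C i p"
proof -
  let ?z = "zero_obj C"
  have z: "?z \<in> Obj C" using zero_object by (simp add: zero_object_def)
  have iA: "i \<in> Arr C" using i cofs_Arr by auto
  have to0: "\<And>a. a \<in> Obj C \<Longrightarrow> \<exists>!f. f \<in> hom C a ?z" and from0: "\<And>a. a \<in> Obj C \<Longrightarrow> \<exists>!f. f \<in> hom C ?z a"
    using zero_object by (auto simp: zero_object_def)
  have ih: "i \<in> hom C (Dom C i) (Cod C i)" using iA by (simp add: hom_def)
  obtain f where f: "f \<in> hom C (Dom C i) ?z" using to0[OF Dom_Obj[OF iA]] by blast
  have pif: "Comp C p i = f" using Comp_hom[OF ih p] f to0[OF Dom_Obj[OF iA]] by blast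
  have "is_pushout C i f p (Ident C ?z)"
    unfolding is_pushout_def
  proof (intro conjI ballI impI)
    show "Comp C p i = Comp C (Ident C ?z) f" using pif Comp_Ident_left[OF f] by simp
    fix u v assume uv: "u \<in> Arr C" "v \<in> Arr C"
      "Dom C u = Cod C i \<and> Dom C v = Cod C f \<and> Cod C u = Cod C v \<and> Comp C u i = Comp C v f"
    have u: "u \<in> hom C (Cod C i) (Cod C u)" and v: "v \<in> hom C ?z (Cod C u)"
      using uv f by (auto simp: hom_def)
    \<comment> \<open>Both sides agree after precomposition with \<open>i\<close>. If
      \<open>i\<close> is invertible it can be cancelled; if its codomain is zero, both are arrows
      out of the zero object.\<close>
    have vp: "Comp C v p = u" using assms(3)
    proof
      assume "Cod C i = ?z"
      then show ?thesis
        using u Comp_hom[OF p v] from0[OF Cod_Obj[OF uv(1)]] by auto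
    next
      assume "is_iso C i"
      then obtain k where k: "k \<in> hom C (Cod C i) (Dom C i)" "Comp C i k = Ident C (Cod C i)"
        by (auto simp: is_iso_def)
      have "Comp C (Comp C v p) i = Comp C u i"
        using Comp_assoc[OF ih p v] pif uv by simp
      then have "Comp C (Comp C v p) (Comp C i k) = Comp C u (Comp C i k)"
        using Comp_assoc[OF k(1) ih u] Comp_assoc[OF k(1) ih Comp_hom[OF p v]] by simp
      then show ?thesis
        using Comp_Ident_right[OF u] Comp_Ident_right[OF Comp_hom[OF p v]] k by simp
    qed
    show "\<exists>!h. h \<in> hom C (Cod C p) (Cod C u) \<and> Comp C h p = u \<and> Comp C h (Ident C ?z) = v"
    proof (rule ex1I[of _ v])
      show "v \<in> hom C (Cod C p) (Cod C u) \<and> Comp C v p = u \<and> Comp C v (Ident C ?z) = v"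
        using v p vp Comp_Ident_right[OF v] by (simp add: hom_def)
      fix h assume "h \<in> hom C (Cod C p) (Cod C u) \<and> Comp C h p = u \<and> Comp C h (Ident C ?z) = v"
      then show "h = v" using p Comp_Ident_right[of h ?z "Cod C u"] by (simp add: hom_def)
    qed
  qed (use iA f p Ident_hom[OF z] in \<open>auto simp: hom_def\<close>)
  then show ?thesis using i f by (auto simp: cofibration_sequence_def)
qed

text \<open>The quotient at \<open>(j, k)\<close> is zero because \<open>j > 0\<close>. The first
  map is the identity of \<open>X\<close>, or ends at zero and starts at \<open>X\<close> or zero;
  the assumption \<open>cof\<close> covers the jump from \<open>X\<close> to zero.\<close>

lemma S_obj_first_row_diagram:
  assumes X: "X \<in> Obj C" and cof: "\<And>f. f \<in> hom C X (zero_obj C) \<Longrightarrow> f \<in> cofs C"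
  shows "S_obj C I (first_row_diagram C X I m)" (is "S_obj C I ?F")
  unfolding S_obj_def
proof (intro conjI ballI impI)
  \<comment> \<open>The clause \<open>0 < snd x\<close> of \<open>first_row\<close> matters here: it
    keeps the entry at \<open>(0, 0)\<close> zero.\<close>
  fix j assume "j \<in> I"
  then show "fobj ?F (j, j) = zero_obj C"
    by (auto simp: first_row_diagram_def first_row_obj_def first_row_def Ar_simps)
next
  fix i j k assume I: "i \<in> I" "j \<in> I" "k \<in> I" and ijk: "i < j \<and> j < k"
  let ?o = "first_row_obj C X m"
  let ?i = "farr ?F ((i, j), (i, k))" and ?p = "farr ?F ((i, k), (j, k))"
  have A: "((i, j), (i, k)) \<in> Arr (Ar I)" "((i, k), (j, k)) \<in> Arr (Ar I)"
    using I ijk by (auto simp: Ar_simps)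
  have ih: "?i \<in> hom C (?o (i, j)) (?o (i, k))" and ph: "?p \<in> hom C (?o (i, k)) (?o (j, k))"
    using first_row_diagram_arr_hom[OF X A(1)] first_row_diagram_arr_hom[OF X A(2)] by auto
  have jk: "?o (j, k) = zero_obj C" using ijk by (simp add: first_row_obj_def first_row_def)
  have c: "Cod C ?i = ?o (i, k)" using ih by (simp add: hom_def)
  have "is_iso C ?i \<and> ?i \<in> cofs C \<or> Cod C ?i = zero_obj C \<and> ?i \<in> cofs C"
  proof (cases "first_row m (i, k)")
    case True
    then have "?i = Ident C X"
      using A ijk by (simp add: first_row_diagram_def first_row_def)
    then show ?thesis using is_iso_Ident[OF X] iso_cof by simp
  next
    case False
    then have k: "?o (i, k) = zero_obj C" by (simp add: first_row_obj_def)
    have "?o (i, j) = X \<or> ?o (i, j) = zero_obj C" by (simp add: first_row_obj_def)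
    then have "?i \<in> cofs C" using ih cof zero_cof unfolding k by auto
    then show ?thesis using k c by simp
  qed
  then show "cofibration_sequence C ?i ?p"
    using cofibration_sequence_zero_cokernel[of ?i ?p] ph jk c by auto
qed

lemma first_row_diagram_in_wS:
  assumes X: "X \<in> Obj C" and cof: "\<And>f. f \<in> hom C X (zero_obj C) \<Longrightarrow> f \<in> cofs C"
  shows "first_row_diagram C X I m \<in> Obj (wS_cat C I)"
  using is_functor_first_row_diagram[OF X, of I m] S_obj_first_row_diagram[OF X cof, of I m]
  by (simp add: wS_cat_def wide_subcat_def S_cat_def full_subcat_def functor_cat_def Let_def)
    (simp add: first_row_diagram_def)

end

section \<open>Two non-isomorphic diagrams with the same image\<close>

lemma restrict_first_row_diagram_eq:
  assumes "J \<subseteq> I" "\<not> {0, Suc m} \<subseteq> J"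
  shows "restrict_diagram J (first_row_diagram C X I (Suc m)) = restrict_diagram J (first_row_diagram C X I m)"
proof -
  \<comment> \<open>The two diagrams differ only at the entry \<open>(0, Suc m)\<close>, which is an
    object of \<open>Ar J\<close> only if \<open>J\<close> contains both \<open>0\<close> and
    \<open>Suc m\<close>.\<close>
  have row: "first_row (Suc m) x = first_row m x" if "x \<in> Obj (Ar J)" for x
    using that assms(2) by (auto simp: Ar_simps first_row_def le_Suc_eq)
  then have obj: "first_row_obj C X (Suc m) x = first_row_obj C X m x" if "x \<in> Obj (Ar J)" for x
    using that by (simp add: first_row_obj_def)
  have "Obj (Ar J) \<subseteq> Obj (Ar I)" "Arr (Ar J) \<subseteq> Arr (Ar I)"
    using assms(1) by (auto simp: Ar_simps)
  moreover have "fst f \<in> Obj (Ar J)" "snd f \<in> Obj (Ar J)" if "f \<in> Arr (Ar J)" for f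
    using that by (auto simp: Ar_simps)
  ultimately show ?thesis
    unfolding restrict_diagram_def
    by (auto simp: first_row_diagram_def row obj intro!: restrict_ext dest: subsetD)
qed

text \<open>A quasi-inverse sends the common image of the two diagrams to one object
  \<open>B\<close>, to which both are then isomorphic. At the entry \<open>(0, j)\<close> this makes
  \<open>X\<close> isomorphic to zero.\<close>

lemma two_segal_map_not_equivalence:
  assumes C: "waldhausen_category C" and X: "X \<in> Obj C"
    and cof: "\<And>f. f \<in> hom C X (zero_obj C) \<Longrightarrow> f \<in> cofs C"
    and nz: "\<And>f. f \<in> hom C (zero_obj C) X \<Longrightarrow> \<not> is_iso C f"
    and T: "\<And>J. J \<in> T \<Longrightarrow> J \<subseteq> {0..n}"
    and j: "1 \<le> j" "j \<le> n" "\<And>J. J \<in> T \<Longrightarrow> \<not> {0, j} \<subseteq> J"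
  shows "\<not> is_equivalence (wS_cat C {0..n}) (wS_holim C n T) (two_segal_map C n T)"
proof
  interpret waldhausen_category C by fact
  let ?W = "wS_cat C {0..n}" and ?F = "two_segal_map C n T"
  let ?A = "first_row_diagram C X {0..n}"
  assume "is_equivalence ?W (wS_holim C n T) ?F"
  then obtain G s where s: "nat_iso ?W ?W id_func (comp_func G ?F) s"
    unfolding is_equivalence_def by blast
  obtain m where m: "j = Suc m" using j by (cases j) auto
  \<comment> \<open>A diagonal lies in some triangle, so it does not contain both \<open>0\<close>
    and \<open>j\<close> either.\<close>
  have "restrict_diagram J (?A j) = restrict_diagram J (?A m)" if "J \<in> triangulation_poset n T" for J
    unfolding m using that T j m
    by (intro restrict_first_row_diagram_eq) (fastforce simp: triangulation_poset_def diagonals_def)+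
  \<comment> \<open>The images are equal, not just isomorphic, because the comparison isomorphisms
    of an image are identities.\<close>
  then have "fobj ?F (?A j) = fobj ?F (?A m)"
    by (auto simp: two_segal_map_def to_holim_def restriction_def fun_eq_iff restrict_def)
  then obtain B where B: "B = fobj (comp_func G ?F) (?A j)" "B = fobj (comp_func G ?F) (?A m)"
    by (simp add: comp_func_def)
  have DC: "Dom ?W = nsrc" "Cod ?W = ntgt"
    by (simp_all add: wS_cat_def wide_subcat_def S_cat_def full_subcat_def functor_cat_def Let_def)
  have x: "(0, j) \<in> Obj (Ar {0..n})" using j by (simp add: Ar_simps)
  have iso: "is_iso ?W (s (?A i))" "nsrc (s (?A i)) = ?A i" "ntgt (s (?A i)) = fobj (comp_func G ?F) (?A i)" for i
    using s first_row_diagram_in_wS[OF X cof, of "{0..n}" i]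
    by (auto simp: nat_iso_def nat_transf_def hom_def DC id_func_def)
  have ob: "fobj (?A j) (0, j) = X" "fobj (?A m) (0, j) = zero_obj C"
    using x j m by (auto simp: first_row_diagram_def first_row_obj_def first_row_def)
  obtain f where f: "f \<in> hom C X (fobj B (0, j))" "is_iso C f"
    using wS_iso_component[OF iso(1)[of j] x] unfolding iso B(1)[symmetric] ob by blast
  obtain f' where f': "f' \<in> hom C (fobj B (0, j)) X" "is_iso C f'"
    using is_iso_inverse[OF f] .
  obtain g where g: "g \<in> hom C (zero_obj C) (fobj B (0, j))" "is_iso C g"
    using wS_iso_component[OF iso(1)[of m] x] unfolding iso B(2)[symmetric] ob by blast
  show False
    using nz[OF Comp_hom[OF g(1) f'(1)]] is_iso_comp[OF g f'] by blast
qed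

section \<open>Finite sets and partial functions\<close>

text \<open>The category is to be carried by natural numbers: \<open>set_decode\<close> reads an
  object as a finite set, and a partial function is stored as the code of its finite graph.\<close>

definition pmap_code :: "(nat \<rightharpoonup> nat) \<Rightarrow> nat" where
  "pmap_code f = set_encode (prod_encode ` Map.graph f)"

definition pmor :: "nat \<Rightarrow> (nat \<rightharpoonup> nat) \<Rightarrow> nat \<Rightarrow> nat" where
  "pmor a f b = prod_encode (a, prod_encode (b, pmap_code f))"

definition pdom :: "nat \<Rightarrow> nat" where
  "pdom m = fst (prod_decode m)"

definition pcod :: "nat \<Rightarrow> nat" where
  "pcod m = fst (prod_decode (snd (prod_decode m)))"

text \<open>The inverse is taken on functions of finite domain, where \<open>pmap_code\<close> is
  injective.\<close>

definition pmap :: "nat \<Rightarrow> (nat \<rightharpoonup> nat)" where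
  "pmap m = inv_into {f. finite (dom f)} pmap_code (snd (prod_decode (snd (prod_decode m))))"

definition pmaps :: "nat \<Rightarrow> nat \<Rightarrow> (nat \<rightharpoonup> nat) set" where
  "pmaps a b = {f. dom f \<subseteq> set_decode a \<and> ran f \<subseteq> set_decode b}"

definition pid :: "nat \<Rightarrow> (nat \<rightharpoonup> nat)" where
  "pid a = (\<lambda>x. if x \<in> set_decode a then Some x else None)"

text \<open>Injectivity is required only where the function is defined, so points may go to the base
  point. This makes the map from any object to zero a cofibration that need not be a
  monomorphism.\<close>

definition pinj :: "(nat \<rightharpoonup> nat) \<Rightarrow> bool" where
  "pinj f \<longleftrightarrow> (\<forall>x y z. f x = Some z \<and> f y = Some z \<longrightarrow> x = y)"

text \<open>Deleting base points turns finite pointed sets into finite sets and partial functions; the empty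
  set \<open>0\<close> is the zero object. Letting all morphisms be weak equivalences makes the gluing axiom void.\<close>

definition pfun_cat :: "(nat, nat) wald" where
  "pfun_cat = \<lparr>Obj = UNIV, Arr = {pmor a f b | a f b. f \<in> pmaps a b}, Dom = pdom, Cod = pcod,
    Ident = (\<lambda>a. pmor a (pid a) a),
    Comp = (\<lambda>g f. pmor (pdom f) (pmap g \<circ>\<^sub>m pmap f) (pcod g)),
    zero_obj = 0,
    cofs = {pmor a f b | a f b. f \<in> pmaps a b \<and> pinj f},
    weqs = {pmor a f b | a f b. f \<in> pmaps a b}\<rparr>"

lemma inj_on_pmap_code: "inj_on pmap_code {f. finite (dom f)}"
proof (rule inj_onI)
  fix f g :: "nat \<rightharpoonup> nat" assume "f \<in> {f. finite (dom f)}" "g \<in> {f. finite (dom f)}" "pmap_code f = pmap_code g"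
  then have "prod_encode ` Map.graph f = prod_encode ` Map.graph g"
    by (simp add: pmap_code_def set_encode_eq)
  then have "Map.graph f = Map.graph g"
    using inj_prod_encode[of UNIV] by (simp add: inj_image_eq_iff)
  then have "f x = Some y \<longleftrightarrow> g x = Some y" for x y
    by (auto simp: Map.graph_def set_eq_iff)
  then show "f = g" by (metis ext option.exhaust)
qed

lemma pmaps_finite_dom: "f \<in> pmaps a b \<Longrightarrow> finite (dom f)"
  by (auto simp: pmaps_def intro: finite_subset[OF _ finite_set_decode])

lemma pmor_sel [simp]:
  "pdom (pmor a f b) = a" "pcod (pmor a f b) = b"
  "f \<in> pmaps c d \<Longrightarrow> pmap (pmor a f b) = f"
  using inv_into_f_f[OF inj_on_pmap_code] pmaps_finite_dom
  by (auto simp: pdom_def pcod_def pmap_def pmor_def)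

lemma pmor_eq_iff:
  assumes "f \<in> pmaps a b" "f' \<in> pmaps a' b'"
  shows "pmor a f b = pmor a' f' b' \<longleftrightarrow> a = a' \<and> f = f' \<and> b = b'"
  using assms pmor_sel by metis

lemma pfun_cat_simps [simp]:
  "Obj pfun_cat = UNIV" "Dom pfun_cat = pdom" "Cod pfun_cat = pcod" "Ident pfun_cat a = pmor a (pid a) a" "zero_obj pfun_cat = 0"
  "weqs pfun_cat = Arr pfun_cat"
  by (simp_all add: pfun_cat_def)

lemma Arr_pfun_cat: "m \<in> Arr pfun_cat \<longleftrightarrow> (\<exists>a f b. m = pmor a f b \<and> f \<in> pmaps a b)"
  by (auto simp: pfun_cat_def)

lemma cofs_pfun_cat: "m \<in> cofs pfun_cat \<longleftrightarrow> (\<exists>a f b. m = pmor a f b \<and> f \<in> pmaps a b \<and> pinj f)"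
  by (auto simp: pfun_cat_def)

lemma hom_pfun_cat: "m \<in> hom pfun_cat a b \<longleftrightarrow> (\<exists>f. m = pmor a f b \<and> f \<in> pmaps a b)"
  by (auto simp: hom_def Arr_pfun_cat)

lemma Comp_pfun_cat [simp]:
  "f \<in> pmaps a b \<Longrightarrow> g \<in> pmaps b c \<Longrightarrow> Comp pfun_cat (pmor b g c) (pmor a f b) = pmor a (g \<circ>\<^sub>m f) c"
  by (simp add: pfun_cat_def)

lemma pmaps_comp [simp]: "f \<in> pmaps a b \<Longrightarrow> g \<in> pmaps b c \<Longrightarrow> g \<circ>\<^sub>m f \<in> pmaps a c"
  by (fastforce simp: pmaps_def dom_def ran_def map_comp_def split: option.splits)

lemma pmaps_pid [simp]: "pid a \<in> pmaps a a"
  by (auto simp: pmaps_def pid_def dom_def ran_def split: if_splits)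

lemma pmaps_NoneD: "f \<in> pmaps a b \<Longrightarrow> x \<notin> set_decode a \<Longrightarrow> f x = None"
  by (auto simp: pmaps_def)

lemma pmaps_SomeD: "f \<in> pmaps a b \<Longrightarrow> f x = Some y \<Longrightarrow> x \<in> set_decode a \<and> y \<in> set_decode b"
  by (auto simp: pmaps_def ran_def)

lemma comp_pid:
  assumes "f \<in> pmaps a b"
  shows "pid b \<circ>\<^sub>m f = f" "f \<circ>\<^sub>m pid a = f"
  using pmaps_SomeD[OF assms] pmaps_NoneD[OF assms]
  by (auto simp: map_comp_def pid_def fun_eq_iff split: option.splits)

lemma map_comp_assoc: "h \<circ>\<^sub>m (g \<circ>\<^sub>m f) = (h \<circ>\<^sub>m g) \<circ>\<^sub>m f"
  by (auto simp: map_comp_def fun_eq_iff split: option.splits)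

section \<open>Category axioms and zero object\<close>

lemma category_pfun_cat: "category pfun_cat"
proof
  fix a b c d f g h
  show "f \<in> Arr pfun_cat \<Longrightarrow> Dom pfun_cat f \<in> Obj pfun_cat" "f \<in> Arr pfun_cat \<Longrightarrow> Cod pfun_cat f \<in> Obj pfun_cat"
    by simp_all
  show "Ident pfun_cat a \<in> hom pfun_cat a a" by (auto simp: hom_pfun_cat)
  assume "f \<in> hom pfun_cat a b"
  then obtain f' where f: "f = pmor a f' b" "f' \<in> pmaps a b" by (auto simp: hom_pfun_cat)
  show "Comp pfun_cat (Ident pfun_cat b) f = f" "Comp pfun_cat f (Ident pfun_cat a) = f"
    using f by (simp_all add: comp_pid)
  assume "g \<in> hom pfun_cat b c"
  then obtain g' where g: "g = pmor b g' c" "g' \<in> pmaps b c" by (auto simp: hom_pfun_cat)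
  show "Comp pfun_cat g f \<in> hom pfun_cat a c" using f g by (auto simp: hom_pfun_cat)
  assume "h \<in> hom pfun_cat c d"
  then obtain h' where h: "h = pmor c h' d" "h' \<in> pmaps c d" by (auto simp: hom_pfun_cat)
  show "Comp pfun_cat h (Comp pfun_cat g f) = Comp pfun_cat (Comp pfun_cat h g) f"
    using f g h by (simp add: map_comp_assoc)
qed

lemma pmaps_zero: "f \<in> pmaps a 0 \<longleftrightarrow> f = Map.empty" "f \<in> pmaps 0 a \<longleftrightarrow> f = Map.empty"
  by (auto simp: pmaps_def ran_def fun_eq_iff) (metis option.exhaust)

lemma zero_object_pfun_cat: "zero_object pfun_cat 0"
  by (auto simp: zero_object_def hom_pfun_cat pmaps_zero)

section \<open>Pushouts along partial injections\<close>

lemma is_pushout_pfun_cat: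
  assumes i: "i \<in> pmaps a b" and f: "f \<in> pmaps a x" and g: "g \<in> pmaps b p" and j: "j \<in> pmaps x p"
    and comm: "g \<circ>\<^sub>m i = j \<circ>\<^sub>m f"
    and univ: "\<And>u v q. u \<in> pmaps b q \<Longrightarrow> v \<in> pmaps x q \<Longrightarrow> u \<circ>\<^sub>m i = v \<circ>\<^sub>m f \<Longrightarrow>
      \<exists>!h. h \<in> pmaps p q \<and> h \<circ>\<^sub>m g = u \<and> h \<circ>\<^sub>m j = v"
  shows "is_pushout pfun_cat (pmor a i b) (pmor a f x) (pmor b g p) (pmor x j p)"
  unfolding is_pushout_def
proof (intro conjI ballI impI)
  fix U V assume U: "U \<in> Arr pfun_cat" and V: "V \<in> Arr pfun_cat"
    and e: "Dom pfun_cat U = Cod pfun_cat (pmor a i b) \<and> Dom pfun_cat V = Cod pfun_cat (pmor a f x) \<and> Cod pfun_cat U = Cod pfun_cat V \<and>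
      Comp pfun_cat U (pmor a i b) = Comp pfun_cat V (pmor a f x)"
  obtain u q where u: "U = pmor b u q" "u \<in> pmaps b q" using U e by (auto simp: Arr_pfun_cat)
  obtain v where v: "V = pmor x v q" "v \<in> pmaps x q" using V e u by (auto simp: Arr_pfun_cat)
  have "u \<circ>\<^sub>m i = v \<circ>\<^sub>m f"
    using e u v i f by (simp add: pmor_eq_iff[OF pmaps_comp pmaps_comp])
  from univ[OF u(2) v(2) this] obtain h where h: "h \<in> pmaps p q" "h \<circ>\<^sub>m g = u" "h \<circ>\<^sub>m j = v"
    and un: "\<And>h'. h' \<in> pmaps p q \<Longrightarrow> h' \<circ>\<^sub>m g = u \<Longrightarrow> h' \<circ>\<^sub>m j = v \<Longrightarrow> h' = h" by blast
  show "\<exists>!H. H \<in> hom pfun_cat (Cod pfun_cat (pmor b g p)) (Cod pfun_cat U) \<and>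
      Comp pfun_cat H (pmor b g p) = U \<and> Comp pfun_cat H (pmor x j p) = V"
  proof (rule ex1I[of _ "pmor p h q"])
    show "pmor p h q \<in> hom pfun_cat (Cod pfun_cat (pmor b g p)) (Cod pfun_cat U) \<and>
      Comp pfun_cat (pmor p h q) (pmor b g p) = U \<and> Comp pfun_cat (pmor p h q) (pmor x j p) = V"
      using h g j u v by (auto simp: hom_pfun_cat)
    fix H assume H: "H \<in> hom pfun_cat (Cod pfun_cat (pmor b g p)) (Cod pfun_cat U) \<and>
      Comp pfun_cat H (pmor b g p) = U \<and> Comp pfun_cat H (pmor x j p) = V"
    then obtain h' where h': "H = pmor p h' q" "h' \<in> pmaps p q" using u by (auto simp: hom_pfun_cat)
    have "h' \<circ>\<^sub>m g = u" "h' \<circ>\<^sub>m j = v"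
      using H h' g j u v
      by (simp_all add: pmor_eq_iff[OF pmaps_comp[OF g h'(2)] u(2)] pmor_eq_iff[OF pmaps_comp[OF j h'(2)] v(2)])
    then show "H = pmor p h q" using un h' by simp
  qed
qed (use i f g j comm in \<open>auto simp: Arr_pfun_cat\<close>)

text \<open>The pushout of a partial injection \<open>i : A \<rightarrow> B\<close> along \<open>f : A \<rightarrow> X\<close> is the disjoint union of
  \<open>B - ran i\<close> (even numbers) and of \<open>X\<close> minus the image under \<open>f\<close> of the points that \<open>i\<close> sends to
  the base point (odd numbers).\<close>

lemma pushout_pinj:
  assumes i: "i \<in> pmaps a b" "pinj i" and f: "f \<in> pmaps a x"
  shows "\<exists>g j p. j \<in> pmaps x p \<and> pinj j \<and> is_pushout pfun_cat (pmor a i b) (pmor a f x) (pmor b g p) (pmor x j p)"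
proof -
  \<comment> \<open>Where \<open>i\<close> is undefined, so is its composite with \<open>g\<close>.
    Commutativity therefore forces \<open>j\<close> to be undefined on \<open>K\<close>.\<close>
  define K where "K = {y. \<exists>s. i s = None \<and> f s = Some y}"
  define P where "P = (\<lambda>t. 2 * t) ` (set_decode b - ran i) \<union> (\<lambda>y. 2 * y + 1) ` (set_decode x - K)"
  define p where "p = set_encode P"
  define j where "j = (\<lambda>y. if y \<in> set_decode x - K then Some (2 * y + 1) else None)"
  \<comment> \<open>On \<open>ran i\<close> the value is forced by commutativity; the chosen
    preimage is the only one because \<open>i\<close> is a partial injection.\<close>
  define g where "g = (\<lambda>t. if t \<in> ran i then (j \<circ>\<^sub>m f) (SOME s. i s = Some t)
    else if t \<in> set_decode b then Some (2 * t) else None)"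
  have "finite P" by (simp add: P_def)
  then have p: "set_decode p = P" by (simp add: p_def)
  have pre: "(SOME s. i s = Some t) = s" if "i s = Some t" for s t
    using that i(2) by (intro some_equality) (auto simp: pinj_def)
  have g_ran: "g t = (j \<circ>\<^sub>m f) s" if "i s = Some t" for s t
    using that pre[OF that] by (auto simp: g_def ran_def)
  have g_notran: "g t = Some (2 * t)" if "t \<in> set_decode b - ran i" for t
    using that by (auto simp: g_def)
  have jp: "j \<in> pmaps x p" and jinj: "pinj j"
    by (auto simp: j_def pmaps_def p P_def dom_def ran_def pinj_def split: if_splits)
  have ib: "ran i \<subseteq> set_decode b" using i by (auto simp: pmaps_def)
  have gp: "g \<in> pmaps b p"
    unfolding pmaps_def mem_Collect_eq
  proof
    show "dom g \<subseteq> set_decode b" using ib by (auto simp: g_def split: if_splits)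
    show "ran g \<subseteq> set_decode p"
    proof
      fix z assume "z \<in> ran g"
      then obtain t where t: "g t = Some z" by (auto simp: ran_def)
      show "z \<in> set_decode p"
      proof (cases "t \<in> ran i")
        case True
        then obtain s where "i s = Some t" by (auto simp: ran_def)
        then have "(j \<circ>\<^sub>m f) s = Some z" using t g_ran by simp
        then show ?thesis using pmaps_SomeD[OF pmaps_comp[OF f jp]] by blast
      next
        case False
        then show ?thesis using t by (auto simp: g_def p P_def split: if_splits)
      qed
    qed
  qed
  have jK: "j y = None" if "y \<in> K" for y using that by (simp add: j_def)
  have comm: "g \<circ>\<^sub>m i = j \<circ>\<^sub>m f"
  proof
    fix s show "(g \<circ>\<^sub>m i) s = (j \<circ>\<^sub>m f) s"
      using g_ran[of s] jK[of "the (f s)"] by (cases "i s"; cases "f s") (force simp: map_comp_def K_def)+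
  qed
  have "\<exists>!h. h \<in> pmaps p q \<and> h \<circ>\<^sub>m g = u \<and> h \<circ>\<^sub>m j = v"
    if u: "u \<in> pmaps b q" and v: "v \<in> pmaps x q" and uv: "u \<circ>\<^sub>m i = v \<circ>\<^sub>m f" for u v q
  proof -
    \<comment> \<open>Parity tells the two summands apart, and \<open>z div 2\<close> recovers the
      original point in both.\<close>
    define h where "h = (\<lambda>z. if z \<in> P then if even z then u (z div 2) else v (z div 2) else None)"
    have uvs: "(u \<circ>\<^sub>m i) s = (v \<circ>\<^sub>m f) s" for s using uv by simp
    have vK: "v y = None" if y: "y \<in> K" for y
    proof -
      obtain s where "i s = None" "f s = Some y" using y by (auto simp: K_def)
      then show ?thesis using uvs[of s] by (simp add: map_comp_def)
    qed
    have hj: "h \<circ>\<^sub>m j = v"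
      using vK pmaps_NoneD[OF v] by (auto simp: fun_eq_iff h_def j_def map_comp_def P_def image_iff)
    have hg: "(h \<circ>\<^sub>m g) t = u t" for t
    proof (cases "t \<in> ran i")
      case True
      \<comment> \<open>Pulling \<open>t\<close> back to \<open>s\<close> moves the computation to
        the other leg of the square, where \<open>hj\<close> applies.\<close>
      then obtain s where s: "i s = Some t" by (auto simp: ran_def)
      have "(h \<circ>\<^sub>m g) t = ((h \<circ>\<^sub>m g) \<circ>\<^sub>m i) s" using s by (simp add: map_comp_def)
      also have "\<dots> = ((h \<circ>\<^sub>m j) \<circ>\<^sub>m f) s" using comm by (simp add: map_comp_assoc[symmetric])
      also have "\<dots> = u t" using uvs[of s] s hj by simp
      finally show ?thesis .
    next
      case False
      then show ?thesis
        using pmaps_NoneD[OF u] by (auto simp: map_comp_def g_def h_def P_def image_iff)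
    qed
    have hp: "h \<in> pmaps p q"
      using u v by (auto simp: pmaps_def p h_def dom_def ran_def split: if_splits)
    \<comment> \<open>Every point of \<open>P\<close> is a value of \<open>g\<close> or of
      \<open>j\<close>, so \<open>h'\<close> is determined.\<close>
    have un: "h' = h" if h': "h' \<in> pmaps p q" "h' \<circ>\<^sub>m g = u" "h' \<circ>\<^sub>m j = v" for h'
    proof
      fix z show "h' z = h z"
      proof (cases "z \<in> P")
        case True
        then consider t where "z = 2 * t" "t \<in> set_decode b - ran i"
          | y where "z = 2 * y + 1" "y \<in> set_decode x - K" by (auto simp: P_def)
        then show ?thesis
        proof cases
          case 1
          then have "h' z = (h' \<circ>\<^sub>m g) t" using g_notran by (simp add: map_comp_def)
          then show ?thesis using 1 True h' by (simp add: h_def)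
        next
          case 2
          then have "h' z = (h' \<circ>\<^sub>m j) y" by (simp add: map_comp_def j_def)
          then show ?thesis using 2 True h' by (simp add: h_def)
        qed
      next
        case False
        then show ?thesis using pmaps_NoneD[OF h'(1)] by (simp add: p h_def)
      qed
    qed
    show ?thesis
    proof (rule ex1I[of _ h])
      show "h \<in> pmaps p q \<and> h \<circ>\<^sub>m g = u \<and> h \<circ>\<^sub>m j = v" using hp hg hj by blast
    qed (use un in blast)
  qed
  then show ?thesis
    using is_pushout_pfun_cat[OF i(1) f gp jp comm] jp jinj by blast
qed

section \<open>The Waldhausen axioms\<close>

lemma iso_cof_pfun_cat:
  assumes "is_iso pfun_cat m" shows "m \<in> cofs pfun_cat"
proof -
  obtain a f b where m: "m = pmor a f b" "f \<in> pmaps a b"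
    using assms by (auto simp: is_iso_def Arr_pfun_cat)
  obtain k where k: "k \<in> pmaps b a" "Comp pfun_cat (pmor b k a) m = pmor a (pid a) a"
    using assms m by (auto simp: is_iso_def hom_pfun_cat)
  then have e: "k \<circ>\<^sub>m f = pid a"
    using m by (simp add: pmor_eq_iff[OF pmaps_comp pmaps_pid])
  \<comment> \<open>A function with a left inverse separates points.\<close>
  have "pinj f" unfolding pinj_def
  proof (intro allI impI)
    fix x y z assume xy: "f x = Some z \<and> f y = Some z"
    then have "x \<in> set_decode a" "y \<in> set_decode a" using pmaps_SomeD[OF m(2)] by blast+
    moreover have "(k \<circ>\<^sub>m f) x = (k \<circ>\<^sub>m f) y" using xy by (simp add: map_comp_def)
    ultimately show "x = y" unfolding e by (simp add: pid_def)
  qed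
  then show ?thesis using m by (auto simp: cofs_pfun_cat)
qed

text \<open>The only map is the empty one, which is vacuously injective. The case
  \<open>a = 0\<close> is an axiom; the case \<open>b = 0\<close> is the one that the counterexample
  exploits.\<close>

lemma zero_cof_pfun_cat:
  assumes "f \<in> hom pfun_cat a b" "a = 0 \<or> b = 0" shows "f \<in> cofs pfun_cat"
proof -
  have "f = pmor a Map.empty b" "Map.empty \<in> pmaps a b" "pinj Map.empty"
    using assms by (auto simp: hom_pfun_cat pmaps_zero pinj_def)
  then show ?thesis unfolding cofs_pfun_cat by blast
qed

lemma Comp_cof_pfun_cat:
  assumes "f \<in> cofs pfun_cat" "g \<in> cofs pfun_cat" "Cod pfun_cat f = Dom pfun_cat g"
  shows "Comp pfun_cat g f \<in> cofs pfun_cat"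
proof -
  obtain a f' b where f: "f = pmor a f' b" "f' \<in> pmaps a b" "pinj f'" using assms by (auto simp: cofs_pfun_cat)
  obtain g' c where g: "g = pmor b g' c" "g' \<in> pmaps b c" "pinj g'" using assms f by (auto simp: cofs_pfun_cat)
  have "pinj (g' \<circ>\<^sub>m f')" using f(3) g(3) by (auto simp: pinj_def map_comp_Some_iff)
  moreover have "Comp pfun_cat g f = pmor a (g' \<circ>\<^sub>m f') c" using f g by simp
  ultimately show ?thesis using pmaps_comp[OF f(2) g(2)] unfolding cofs_pfun_cat by blast
qed

lemma pushout_pfun_cat:
  assumes "i \<in> cofs pfun_cat" "f \<in> Arr pfun_cat" "Dom pfun_cat i = Dom pfun_cat f"
  shows "\<exists>g j. is_pushout pfun_cat i f g j \<and> j \<in> cofs pfun_cat"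
proof -
  obtain a i' b where i: "i = pmor a i' b" "i' \<in> pmaps a b" "pinj i'" using assms by (auto simp: cofs_pfun_cat)
  obtain f' x where f: "f = pmor a f' x" "f' \<in> pmaps a x" using assms i by (auto simp: Arr_pfun_cat)
  show ?thesis using pushout_pinj[OF i(2,3) f(2)] unfolding i f cofs_pfun_cat by blast
qed

lemma waldhausen_category_pfun_cat: "waldhausen_category pfun_cat"
proof -
  interpret category pfun_cat by (rule category_pfun_cat)
  show ?thesis
  proof
    fix i f g j i' f' g' j' a b c h
    show "zero_object pfun_cat (zero_obj pfun_cat)" by (simp add: zero_object_pfun_cat)
    show "cofs pfun_cat \<subseteq> Arr pfun_cat" using cofs_pfun_cat Arr_pfun_cat by blast
    show "f \<in> hom pfun_cat (zero_obj pfun_cat) a \<Longrightarrow> f \<in> cofs pfun_cat"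
      using zero_cof_pfun_cat by simp
    show "is_iso pfun_cat f \<Longrightarrow> f \<in> cofs pfun_cat" by (rule iso_cof_pfun_cat)
    show "f \<in> cofs pfun_cat \<Longrightarrow> g \<in> cofs pfun_cat \<Longrightarrow> Cod pfun_cat f = Dom pfun_cat g \<Longrightarrow> Comp pfun_cat g f \<in> cofs pfun_cat"
      by (rule Comp_cof_pfun_cat)
    show "i \<in> cofs pfun_cat \<Longrightarrow> f \<in> Arr pfun_cat \<Longrightarrow> Dom pfun_cat i = Dom pfun_cat f \<Longrightarrow> \<exists>g j. is_pushout pfun_cat i f g j"
      using pushout_pfun_cat by blast
    show "j \<in> cofs pfun_cat" if i: "i \<in> cofs pfun_cat" and P: "is_pushout pfun_cat i f g j"
    proof -
      have "f \<in> Arr pfun_cat" "Dom pfun_cat i = Dom pfun_cat f" using P by (simp_all add: is_pushout_def)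
      then obtain g0 j0 where P0: "is_pushout pfun_cat i f g0 j0" "j0 \<in> cofs pfun_cat" using pushout_pfun_cat[OF i] by blast
      \<comment> \<open>An arbitrary pushout differs from the constructed one by an isomorphism,
        which is itself a cofibration.\<close>
      obtain h where "h \<in> hom pfun_cat (Cod pfun_cat j0) (Cod pfun_cat j)" "is_iso pfun_cat h" "Comp pfun_cat h j0 = j"
        using pushout_unique_iso[OF P0(1) P] by blast
      then show ?thesis using Comp_cof_pfun_cat[OF P0(2) iso_cof_pfun_cat] by (auto simp: hom_def)
    qed
    show "weqs pfun_cat \<subseteq> Arr pfun_cat" by simp
    show "is_iso pfun_cat f \<Longrightarrow> f \<in> weqs pfun_cat" by (simp add: is_iso_def)
    show "f \<in> weqs pfun_cat \<Longrightarrow> g \<in> weqs pfun_cat \<Longrightarrow> Cod pfun_cat f = Dom pfun_cat g \<Longrightarrow> Comp pfun_cat g f \<in> weqs pfun_cat"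
      using Comp_hom[of f "Dom pfun_cat f" "Cod pfun_cat f" g "Cod pfun_cat g"] by (simp add: hom_def)
    show "h \<in> weqs pfun_cat" if "h \<in> hom pfun_cat (Cod pfun_cat g) (Cod pfun_cat g')"
      using that by (simp add: hom_def)
  qed
qed

text \<open>Any endomorphism that factors through zero is the empty partial function, which is not
  the identity of a nonempty set.\<close>

lemma from_zero_not_iso_pfun_cat:
  assumes "f \<in> hom pfun_cat (zero_obj pfun_cat) a" "set_decode a \<noteq> {}"
  shows "\<not> is_iso pfun_cat f"
proof
  assume "is_iso pfun_cat f"
  moreover have f: "f = pmor 0 Map.empty a" using assms by (auto simp: hom_pfun_cat pmaps_zero)
  ultimately obtain k where k: "k \<in> pmaps a 0" "Comp pfun_cat f (pmor a k 0) = pmor a (pid a) a"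
    by (auto simp: is_iso_def hom_pfun_cat)
  have e: "Map.empty \<in> pmaps 0 a" by (simp add: pmaps_zero)
  have "Map.empty \<in> pmaps a a" by (simp add: pmaps_def)
  then have "Map.empty = pid a"
    using k f e by (simp add: pmor_eq_iff[OF _ pmaps_pid])
  then show False using assms(2) by (auto simp: pid_def fun_eq_iff split: if_splits)
qed

section \<open>The 2-Segal map\<close>

theorem proposition8p7:
  fixes n :: nat and T :: "nat set set"
  assumes "n \<ge> 3"
    and "polygon_triangulation n T"
    and "\<exists>I \<in> T. 0 \<notin> I"
  shows "\<exists>C :: (nat, nat) wald. waldhausen_category C \<and>
    \<not> is_equivalence (wS_cat C {0..n}) (wS_holim C n T) (two_segal_map C n T)"
proof -
  obtain j where j: "1 < j" "j < n" "\<forall>J \<in> T. \<not> {0, j} \<subseteq> J"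
    using exists_uncovered_diagonal assms(2,3) by blast
  \<comment> \<open>The object \<open>1\<close> codes the one-point set \<open>{0}\<close>, that is,
    the pointed set with two elements; it serves as \<open>X\<close>.\<close>
  have "0 \<in> set_decode 1" by simp
  then have "set_decode 1 \<noteq> {}" by blast
  then have "\<not> is_equivalence (wS_cat pfun_cat {0..n}) (wS_holim pfun_cat n T) (two_segal_map pfun_cat n T)"
    using j assms(2)
    by (intro two_segal_map_not_equivalence[where X = 1 and j = j] waldhausen_category_pfun_cat
        from_zero_not_iso_pfun_cat) (auto simp: polygon_triangulation_def intro: zero_cof_pfun_cat)
  then show ?thesis using waldhausen_category_pfun_cat by blast
qed

end
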